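(* Let $\bar x\in\mathcal H$ be such that $S^h_\Phi(\bar x,0)<h(\bar x)$, and assume that the density $f_\xi$ satisfies the growth condition $$\lim_{\|z\|\to+\infty}\|z\|^{m+1}f_\xi(z)=0.$$ Then, for any given $\lambda>0$, the probability function $\varphi_\lambda$ is continuously differentiable on an appropriate neighbourhood $U$ of $\bar x$ and $$\nabla\varphi_\lambda(x)=\int_{\mathbb S^{m-1}}G_\lambda(x,v)\,d\mu_\zeta(v)\quad\text{for all }x\in U.$$ Moreover, the gradients of $\mathrm e_\lambda S^h_\Phi$ can be computed by the formula $$\nabla(\mathrm e_\lambda S^h_\Phi)(x,z)=\frac{(x,z)-\operatorname{Prox}_{\lambda\Phi^h_{v^*}}(x,z)}{\lambda},\qquad (x,z)\in\mathcal H\times\mathbb R^m,$$ where $v^*$ is any active vector at $(x,z)$, that is, $v^*\in\mathcal C$ and $\mathrm e_\lambda\Phi^h_{v^*}(x,z)=\mathrm e_\lambda S^h_\Phi(x,z)$.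
   Context: $\mathcal H$ is a finite-dimensional real Hilbert space; $\mathcal Y$ is a real Banach space with dual $\mathcal Y^*$; $\mathcal H\times\mathbb R^m$ carries the product inner product. $\mathcal K\subset\mathcal Y$ is a nonempty convex cone, $\mathcal K^+:=\{v^*\in\mathcal Y^*:\langle v^*,v\rangle\ge0\ \forall v\in\mathcal K\}$. $\mathcal C\subset\mathcal Y^*$ is a weak$^*$-compact convex set with $\operatorname{cl}^{w^*}\operatorname{cone}\mathcal C=\mathcal K^+$, where $\operatorname{cone}\mathcal C=\{tc:t\ge0,c\in\mathcal C\}$. $\Phi:\mathcal H\times\mathbb R^m\to\mathcal Y$ and $h:\mathcal H\to\mathbb R$ are such that $h$ is continuously differentiable and convex and, for every $v^*\in\mathcal C$, the function $\Phi^h_{v^*}(x,z):=\langle v^*,\Phi(x,z)\rangle+h(x)$ is convex on $\mathcal H\times\mathbb R^m$. Put $S^h_\Phi(x,z):=\sup_{v^*\in\mathcal C}\Phi^h_{v^*}(x,z)$. For a proper convex lower semicontinuous $f$ on a Hilbert space $X$ and $\lambda>0$: $\mathrm e_\lambda f(u):=\inf_{w\in X}(f(w)+\frac1{2\lambda}\|u-w\|^2)$ (Moreau envelope) and $\operatorname{Prox}_{\lambda f}(u)$ is the unique minimizer $w$. Envelopes below are on $X=\mathcal H\times\mathbb R^m$; $\nabla_x,\nabla_z$ denote the partial gradients. $\xi$ is an $m$-dimensional random vector with continuous Lebesgue density $f_\xi$ and $\mathbb E(\xi)=0$. $\varphi_\lambda(x):=\mathbb P(\mathrm e_\lambda S^h_\Phi(x,\xi)\le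 h(x))$. $L\in\mathbb R^{m\times m}$ is a fixed invertible matrix, $\mathbb S^{m-1}$ is the Euclidean unit sphere of $\mathbb R^m$, $\mu_\zeta$ is the uniform probability measure on $\mathbb S^{m-1}$, and $\theta(r,v):=\frac{2\pi^{m/2}|\det L|}{\Gamma(m/2)}r^{m-1}f_\xi(rLv)$. For $x$ with $\mathrm e_\lambda S^h_\Phi(x,0)<h(x)$ (which holds near $\bar x$) define: $F_\lambda(x):=\{v\in\mathbb S^{m-1}:\exists r>0,\ \mathrm e_\lambda S^h_\Phi(x,rLv)=h(x)\}$, $I_\lambda(x):=\mathbb S^{m-1}\setminus F_\lambda(x)$, $\rho_\lambda(x,v):=\sup\{r>0:\mathrm e_\lambda S^h_\Phi(x,rLv)\le h(x)\}\in(0,+\infty]$, and $$G_\lambda(x,v):=-\theta(\rho_\lambda(x,v),v)\,\frac{\nabla_x(\mathrm e_\lambda S^h_\Phi)(x,\rho_\lambda(x,v)Lv)-\nabla h(x)}{\langle\nabla_z(\mathrm e_\lambda S^h_\Phi)(x,\rho_\lambda(x,v)Lv),Lv\rangle}\ \text{ if }v\in F_\lambda(x),\qquad G_\lambda(x,v):=0\ \text{ if }v\in I_\lambda(x).$$ *)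

theory Defs
  imports "HOL-Probability.Probability"
begin

text \<open>For real-valued operators the topology of pointwise convergence on
  \<^typ>\<open>'y::real_normed_vector \<Rightarrow>\<^sub>L real\<close> is the weak-star topology of the dual space.\<close>

abbreviation weak_star :: "('y::real_normed_vector \<Rightarrow>\<^sub>L real) topology" where
  "weak_star \<equiv> strong_operator_topology"

definition dual_cone :: "'y::real_normed_vector set \<Rightarrow> ('y \<Rightarrow>\<^sub>L real) set" where
  "dual_cone K = {v. \<forall>y\<in>K. 0 \<le> blinfun_apply v y}"

definition generated_cone :: "'a::real_vector set \<Rightarrow> 'a set" where
  "generated_cone C = {t *\<^sub>R c | t c. 0 \<le> t \<and> c \<in> C}"

definition grad :: "('a::real_inner \<Rightarrow> real) \<Rightarrow> 'a \<Rightarrow> 'a" where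
  "grad f x = (THE D. GDERIV f x :> D)"

definition grad_x :: "('a::real_inner \<times> 'b \<Rightarrow> real) \<Rightarrow> 'a \<times> 'b \<Rightarrow> 'a" where
  "grad_x f u = grad (\<lambda>x. f (x, snd u)) (fst u)"

definition grad_z :: "('a \<times> 'b::real_inner \<Rightarrow> real) \<Rightarrow> 'a \<times> 'b \<Rightarrow> 'b" where
  "grad_z f u = grad (\<lambda>z. f (fst u, z)) (snd u)"

text \<open>Only meant for open \<open>U\<close>.\<close>

definition C1_on :: "'a::real_inner set \<Rightarrow> ('a \<Rightarrow> real) \<Rightarrow> bool" where
  "C1_on U f \<longleftrightarrow> (\<forall>x\<in>U. GDERIV f x :> grad f x) \<and> continuous_on U (grad f)"

text \<open>The functions regularised below are finite-valued and convex on a finite-dimensional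
  space, so the real infimum is over a nonempty set bounded below and the minimiser is unique.\<close>

definition moreau_env :: "real \<Rightarrow> ('a::real_inner \<Rightarrow> real) \<Rightarrow> 'a \<Rightarrow> real" where
  "moreau_env lam f u = (INF w. f w + 1 / (2 * lam) * (norm (u - w))\<^sup>2)"

definition prox :: "real \<Rightarrow> ('a::real_inner \<Rightarrow> real) \<Rightarrow> 'a \<Rightarrow> 'a" where
  "prox lam f u =
     (THE w. is_arg_min (\<lambda>w. f w + 1 / (2 * lam) * (norm (u - w))\<^sup>2) (\<lambda>_. True) w)"

definition scalarised ::
  "('h \<times> 'z \<Rightarrow> 'y::real_normed_vector) \<Rightarrow> ('h \<Rightarrow> real) \<Rightarrow> ('y \<Rightarrow>\<^sub>L real) \<Rightarrow> 'h \<times> 'z \<Rightarrow> real" where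
  "scalarised \<Phi> h v u = blinfun_apply v (\<Phi> u) + h (fst u)"

definition sup_scalarised ::
  "('y::real_normed_vector \<Rightarrow>\<^sub>L real) set \<Rightarrow> ('h \<times> 'z \<Rightarrow> 'y) \<Rightarrow> ('h \<Rightarrow> real) \<Rightarrow> 'h \<times> 'z \<Rightarrow> real" where
  "sup_scalarised C \<Phi> h u = (SUP v\<in>C. scalarised \<Phi> h v u)"

text \<open>The uniform probability measure on the unit sphere, as the law of the direction
  \<^term>\<open>sgn z\<close>, i.e. \<open>z / norm z\<close>, of a point \<open>z\<close> uniformly distributed in the unit ball.\<close>

definition sphere_uniform :: "'a::euclidean_space measure" where
  "sphere_uniform =
     restrict_space (distr (uniform_measure lborel (ball 0 1)) borel sgn) (sphere 0 1)"

lemma prob_space_sphere_uniform: "prob_space (sphere_uniform :: 'a::euclidean_space measure)"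
  and space_sphere_uniform: "space (sphere_uniform :: 'a measure) = sphere 0 1"
proof -
  let ?B = "uniform_measure lborel (ball 0 1) :: 'a measure"
  have meas: "sgn \<in> measurable ?B (borel :: 'a measure)"
    unfolding sgn_div_norm by simp
  have pos: "emeasure lborel (ball 0 1 :: 'a set) \<noteq> 0"
    using emeasure_lborel_ball_finite[of "0::'a" 1] content_ball_pos[of 1 "0::'a"]
    by (auto simp: measure_def)
  interpret B: prob_space ?B
    using pos emeasure_lborel_ball_finite[of "0::'a" 1] by (intro prob_space_uniform_measure) auto
  have "emeasure lborel (ball 0 1 \<inter> {0::'a}) = 0"
    by (rule emeasure_eq_0[of "{0}"]) auto
  then have null: "emeasure ?B {0} = 0"
    by (subst emeasure_uniform_measure) auto
  have "sgn -` sphere 0 1 \<inter> space ?B = space ?B - {0::'a}"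
    by (auto simp: norm_sgn)
  then have "emeasure (distr ?B borel sgn) (sphere 0 1) = emeasure ?B (space ?B - {0})"
    using meas by (subst emeasure_distr) auto
  also have "\<dots> = 1"
    using null B.emeasure_space_1 by (subst emeasure_Diff) auto
  finally show "prob_space (sphere_uniform :: 'a measure)"
    unfolding sphere_uniform_def
    by (intro prob_spaceI) (auto simp: space_restrict_space emeasure_restrict_space)
  show "space (sphere_uniform :: 'a measure) = sphere 0 1"
    by (simp add: sphere_uniform_def space_restrict_space)
qed

definition radial_density ::
  "real^'m^'m \<Rightarrow> (real^'m \<Rightarrow> real) \<Rightarrow> real \<Rightarrow> real^'m \<Rightarrow> real" where
  "radial_density L f r v =
     2 * pi powr (real CARD('m) / 2) * \<bar>det L\<bar> / Gamma (real CARD('m) / 2)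
       * r ^ (CARD('m) - 1) * f (r *\<^sub>R (L *v v))"

text \<open>In the remaining definitions \<open>E\<close> stands for the Moreau envelope of the supremum function.
  They are meant for \<open>x\<close> with \<^prop>\<open>E (x, 0) < h x\<close>; the infinite directions are the
  unit vectors outside \<open>finite_dirs L E h x\<close>.\<close>

definition finite_dirs ::
  "real^'m^'m \<Rightarrow> ('h \<times> (real^'m) \<Rightarrow> real) \<Rightarrow> ('h \<Rightarrow> real) \<Rightarrow> 'h \<Rightarrow> (real^'m) set" where
  "finite_dirs L E h x = {v \<in> sphere 0 1. \<exists>r>0. E (x, r *\<^sub>R (L *v v)) = h x}"

definition radius ::
  "real^'m^'m \<Rightarrow> ('h \<times> (real^'m) \<Rightarrow> real) \<Rightarrow> ('h \<Rightarrow> real) \<Rightarrow> 'h \<Rightarrow> real^'m \<Rightarrow> ereal" where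
  "radius L E h x v = Sup {ereal r | r. 0 < r \<and> E (x, r *\<^sub>R (L *v v)) \<le> h x}"

text \<open>The radius is finite on the finite directions, so \<^const>\<open>real_of_ereal\<close> loses nothing.\<close>

definition gradient_integrand ::
  "real^'m^'m \<Rightarrow> (real^'m \<Rightarrow> real) \<Rightarrow> ('h::real_inner \<times> (real^'m) \<Rightarrow> real) \<Rightarrow> ('h \<Rightarrow> real)
    \<Rightarrow> 'h \<Rightarrow> real^'m \<Rightarrow> 'h" where
  "gradient_integrand L f E h x v =
     (if v \<in> finite_dirs L E h x then
        let r = real_of_ereal (radius L E h x v); u = (x, r *\<^sub>R (L *v v))
        in - (radial_density L f r v / (grad_z E u \<bullet> (L *v v))) *\<^sub>R (grad_x E u - grad h x)
      else 0)"

definition prob_function ::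
  "'w measure \<Rightarrow> ('w \<Rightarrow> 'z) \<Rightarrow> ('h \<times> 'z \<Rightarrow> real) \<Rightarrow> ('h \<Rightarrow> real) \<Rightarrow> 'h \<Rightarrow> real" where
  "prob_function M \<xi> E h x = measure M {\<omega> \<in> space M. E (x, \<xi> \<omega>) \<le> h x}"

end

theory Submission
  imports Defs
begin

text \<open>
  The Moreau envelope \<open>E\<close> of the supremum function is convex with a Lipschitz gradient. An active
  vector exists by a minimax argument (separation in the plane settles two test points, then
  induction and weak-star compactness settle the rest), and it has the gradient of \<open>E\<close> because
  its own envelope touches \<open>E\<close> from below.

  In polar coordinates the probability is the mean over directions \<open>v\<close> of the integral of the
  radial density over an initial segment of the ray, of length \<open>\<rho>(x, v)\<close>, possibly infinite. By
  convexity the slope of \<open>E\<close> where the ray leaves the sublevel set is at least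
  \<open>(h(x) - E(x, 0)) / \<rho>\<close>, so \<open>\<rho>\<close> is differentiable where it is finite, and the integrand \<open>G\<close> is
  \<open>O(\<rho>\<^sup>2)\<close> times the radial density. The growth condition is exactly what makes this vanish as
  \<open>\<rho>\<close> tends to infinity: \<open>G\<close> is jointly continuous, and differentiation under the integral over
  the compact sphere is legitimate.
\<close>

subsection \<open>Gradients\<close>

text \<open>The obstacle is the set of infinite directions: an arbitrarily small change of
  \<open>x\<close> may turn such a direction into a finite one, so no implicit function describes
  the radius there. What replaces it is the subgradient inequality between a crossing point over
  \<open>x\<close> and the point of the same radius over \<open>x0\<close>. Along a ray that is
  infinite for \<open>x0\<close> the envelope stays below its value at the origin, so a gap of fixed
  size has to be bridged by the \<open>x\<close>-component alone, and this forces the radius to be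
  at least of order 1 / norm (x - x0). The two powers of the radius in the bound on \<open>G\<close>
  have separate origins: one is the reciprocal of the crossing slope, the other the linear growth of
  a Lipschitz gradient. Together with the power m - 1 of polar coordinates they make up the exponent
  m + 1 of the growth condition. The envelope lies below the supremum function and so inherits the
  strict inequality at \<open>xbar\<close>.\<close>

lemma GDERIV_unique:
  assumes "GDERIV f x :> D" "GDERIV f x :> D'"
  shows "D = D'"
proof -
  have "(\<lambda>h. inner h D) = (\<lambda>h. inner h D')"
    using assms has_derivative_unique unfolding gderiv_def by blast
  then have "inner (D - D') D = inner (D - D') D'" by (rule fun_cong)
  then have "inner (D - D') (D - D') = 0" by (simp only: inner_diff_right)
  then show ?thesis by simp
qed

lemma grad_eq:
  assumes "GDERIV f x :> D"
  shows "grad f x = D"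
  unfolding grad_def using assms GDERIV_unique by (blast intro: the_equality)

lemma GDERIV_I:
  assumes "\<And>e. 0 < e \<Longrightarrow> \<exists>d>0. \<forall>y. norm (y - x) < d \<longrightarrow> \<bar>f y - f x - D \<bullet> (y - x)\<bar> \<le> e * norm (y - x)"
  shows "GDERIV f x :> D"
  unfolding gderiv_def has_derivative_within_alt
  using assms by (auto simp: inner_commute intro: bounded_linear_inner_left)

lemma quadratic_bound_GDERIV:
  assumes "\<And>y. \<bar>f y - f x - D \<bullet> (y - x)\<bar> \<le> c * (norm (y - x))\<^sup>2" "0 < c"
  shows "GDERIV f x :> D"
proof (rule GDERIV_I)
  fix e :: real assume "0 < e"
  show "\<exists>d>0. \<forall>y. norm (y - x) < d \<longrightarrow> \<bar>f y - f x - D \<bullet> (y - x)\<bar> \<le> e * norm (y - x)"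
  proof (intro exI conjI allI impI)
    show "0 < e / c" using \<open>0 < e\<close> \<open>0 < c\<close> by simp
    fix y assume "norm (y - x) < e / c"
    then have "c * norm (y - x) \<le> e" using \<open>0 < c\<close> by (simp add: field_simps)
    then have "c * norm (y - x) * norm (y - x) \<le> e * norm (y - x)"
      by (rule mult_right_mono) simp
    then show "\<bar>f y - f x - D \<bullet> (y - x)\<bar> \<le> e * norm (y - x)"
      using assms(1)[of y] by (simp add: power2_eq_square)
  qed
qed

subsection \<open>Moreau envelopes\<close>

text \<open>Continuity bounds \<open>f\<close> on the unit ball around \<open>u\<close>. Going from
  \<open>w\<close> through \<open>u\<close> one unit further stays in that ball, and convexity on
  this segment bounds \<open>f w\<close> from below linearly in the distance. This is the coercivity
  that the proximal objective needs.\<close>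

lemma convex_on_linear_minorant:
  fixes f :: "'a::euclidean_space \<Rightarrow> real"
  assumes "convex_on UNIV f"
  obtains B where "0 \<le> B" "\<And>w. f u - B * (1 + norm (w - u)) \<le> f w"
proof -
  have cont: "continuous_on UNIV f"
    using assms convex_on_continuous open_UNIV by blast
  have "bounded (f ` cball u 1)"
    by (intro compact_imp_bounded compact_continuous_image continuous_on_subset[OF cont] compact_cball) simp
  then obtain B0 where B0: "\<And>w. w \<in> cball u 1 \<Longrightarrow> \<bar>f w\<bar> \<le> B0"
    unfolding bounded_iff real_norm_def by blast
  have u0: "\<bar>f u\<bar> \<le> B0" using B0[of u] by simp
  show ?thesis
  proof
    show "0 \<le> 2 * B0" using u0 by simp
    fix w
    show "f u - 2 * B0 * (1 + norm (w - u)) \<le> f w"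
    proof (cases "w = u")
      case True then show ?thesis using u0 by simp
    next
      case False
      define n where "n = norm (w - u)"
      have n: "0 < n" using False by (simp add: n_def)
      \<comment> \<open>Opposite to \<open>w\<close>, at distance 1 from \<open>u\<close>; the
        weight \<open>t\<close> below is the one that makes \<open>u\<close> the combination of
        \<open>p\<close> and \<open>w\<close>.\<close>
      define p where "p = u - (1 / n) *\<^sub>R (w - u)"
      have p: "p \<in> cball u 1"
        using n by (simp add: p_def dist_norm n_def)
      define t where "t = 1 / (1 + n)"
      have t: "0 \<le> t" "t \<le> 1" using n by (auto simp: t_def)
      have "(1 - t) *\<^sub>R p + t *\<^sub>R w = u + ((t - (1 - t) / n)) *\<^sub>R (w - u)"
        by (simp add: p_def algebra_simps)
      also have "t - (1 - t) / n = 0"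
      proof -
        have "1 - t = t * n" using n by (simp add: t_def divide_simps)
        then show ?thesis using n by simp
      qed
      finally have eq: "(1 - t) *\<^sub>R p + t *\<^sub>R w = u" by simp
      have "f ((1 - t) *\<^sub>R p + t *\<^sub>R w) \<le> (1 - t) * f p + t * f w"
        using assms t by (intro convex_onD) auto
      then have "f u \<le> (1 - t) * f p + t * f w" using eq by simp
      then have "(1 + n) * f u \<le> (1 + n) * ((1 - t) * f p + t * f w)"
        using n by (intro mult_left_mono) auto
      also have "\<dots> = n * f p + f w"
      proof -
        have "(1 + n) * t = 1" "(1 + n) * (1 - t) = n" using n by (auto simp: t_def divide_simps)
        then show ?thesis by (simp only: distrib_left mult.assoc[symmetric])
      qed
      finally have "(1 + n) * f u \<le> n * f p + f w" .
      moreover have "n * (f p - f u) \<le> n * (2 * B0)"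
        using n B0[OF p] u0 by (intro mult_left_mono) auto
      ultimately show ?thesis using u0 n unfolding n_def by (simp add: algebra_simps)
    qed
  qed
qed

text \<open>The quadratic outgrows the linear minorant of \<open>f\<close>, so minimising over a
  large ball around \<open>u\<close> is enough.\<close>

lemma prox_objective_attains_min:
  fixes f :: "'a::euclidean_space \<Rightarrow> real"
  assumes f: "convex_on UNIV f" and lam: "0 < lam"
  obtains p where "\<And>w. f p + 1 / (2 * lam) * (norm (u - p))\<^sup>2 \<le> f w + 1 / (2 * lam) * (norm (u - w))\<^sup>2"
proof -
  obtain B where B: "0 \<le> B" "\<And>w. f u - B * (1 + norm (w - u)) \<le> f w"
    using convex_on_linear_minorant[OF f] by blast
  let ?q = "\<lambda>w. f w + 1 / (2 * lam) * (norm (u - w))\<^sup>2"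
  have cont: "continuous_on UNIV f"
    using f convex_on_continuous open_UNIV by blast
  \<comment> \<open>For n > R the loss B(1 + n) is at most 2Bn, hence at most n^2 / (2 lam): outside
    the ball the objective is at least \<open>f u\<close>, its value at the centre.\<close>
  define R where "R = max 1 (4 * lam * B)"
  have R: "1 \<le> R" "4 * lam * B \<le> R" by (auto simp: R_def)
  have "\<exists>p\<in>cball u R. \<forall>w\<in>cball u R. ?q p \<le> ?q w"
    using R by (intro continuous_attains_inf continuous_intros continuous_on_subset[OF cont]) auto
  then obtain p where p: "p \<in> cball u R" "\<And>w. w \<in> cball u R \<Longrightarrow> ?q p \<le> ?q w"
    by blast
  have "?q p \<le> ?q w" for w
  proof (cases "w \<in> cball u R")
    case False
    define n where "n = norm (w - u)"
    have n: "R < n" using False by (simp add: n_def dist_norm norm_minus_commute)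
    have "B * (1 + n) \<le> B * (2 * n)"
      using B R n by (intro mult_left_mono) auto
    also have "\<dots> = 1 / (2 * lam) * ((4 * lam * B) * n)"
      using lam by (simp add: field_simps)
    also have "\<dots> \<le> 1 / (2 * lam) * (n * n)"
      using lam n R by (intro mult_left_mono mult_right_mono) auto
    finally have "f u \<le> ?q w"
      using B(2)[of w] unfolding n_def by (simp add: power2_eq_square norm_minus_commute)
    moreover have "?q p \<le> f u" using p(2)[of u] R by simp
    ultimately show ?thesis by simp
  qed (use p in auto)
  then show ?thesis using that by blast
qed

lemma norm_diff_scaleR_sq:
  "(norm (a - t *\<^sub>R b))\<^sup>2 = (norm a)\<^sup>2 - 2 * t * (a \<bullet> b) + t\<^sup>2 * (norm b)\<^sup>2"
  unfolding power2_norm_eq_inner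
  by (simp add: inner_diff inner_commute[of b a] algebra_simps power2_eq_square)

text \<open>On the segment from \<open>p\<close> to \<open>w\<close> the quadratic deviates from its
  linearisation only by order t^2. Minimality divided by t therefore leaves, as t tends to 0, that
  (u - p) / lam is a subgradient of \<open>f\<close> at the minimiser.\<close>

lemma prox_objective_growth:
  fixes f :: "'a::real_inner \<Rightarrow> real"
  assumes f: "convex_on UNIV f" and lam: "0 < lam"
    and p: "\<And>w. f p + 1 / (2 * lam) * (norm (u - p))\<^sup>2 \<le> f w + 1 / (2 * lam) * (norm (u - w))\<^sup>2"
  shows "f p + (1 / lam) *\<^sub>R (u - p) \<bullet> (w - p) \<le> f w"
proof (rule field_le_epsilon)
  fix e :: real assume "0 < e"
  define a where "a = (norm (w - p))\<^sup>2 / (2 * lam)"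
  have a: "0 \<le> a" using lam by (simp add: a_def)
  \<comment> \<open>Small enough for the second-order remainder \<open>t * a\<close> to be at most
    \<open>e\<close>; the added 1 covers \<open>a = 0\<close>.\<close>
  define t where "t = min 1 (e / (a + 1))"
  have t: "0 < t" "t \<le> 1" using a \<open>0 < e\<close> by (auto simp: t_def)
  have "t \<le> e / (a + 1)" by (simp add: t_def)
  then have "t * (a + 1) \<le> e" using a by (simp add: field_simps)
  then have ta: "t * a \<le> e" using t by (simp add: algebra_simps)
  define y where "y = (1 - t) *\<^sub>R p + t *\<^sub>R w"
  have "f y \<le> (1 - t) * f p + t * f w"
    unfolding y_def using f t by (intro convex_onD) auto
  moreover have "u - y = (u - p) - t *\<^sub>R (w - p)"
    by (simp add: y_def algebra_simps)
  then have "(norm (u - y))\<^sup>2 = (norm (u - p))\<^sup>2 - 2 * t * ((u - p) \<bullet> (w - p)) + t\<^sup>2 * (norm (w - p))\<^sup>2"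
    by (simp only: norm_diff_scaleR_sq)
  ultimately have "f p + 1 / (2 * lam) * (norm (u - p))\<^sup>2
     \<le> (1 - t) * f p + t * f w + 1 / (2 * lam) * ((norm (u - p))\<^sup>2 - 2 * t * ((u - p) \<bullet> (w - p)) + t\<^sup>2 * (norm (w - p))\<^sup>2)"
    using p[of y] by simp
  also have "\<dots> = f p + 1 / (2 * lam) * (norm (u - p))\<^sup>2
     + t * (f w - f p - (1 / lam) *\<^sub>R (u - p) \<bullet> (w - p) + t * a)"
    using lam unfolding a_def inner_scaleR_left by (simp add: field_simps power2_eq_square)
  finally have "0 \<le> f w - f p - (1 / lam) *\<^sub>R (u - p) \<bullet> (w - p) + t * a"
    using t by (simp add: zero_le_mult_iff)
  then show "f p + (1 / lam) *\<^sub>R (u - p) \<bullet> (w - p) \<le> f w + e"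
    using ta by simp
qed

text \<open>\<open>prox\<close> is a definite description, so the existence of a minimiser says
  nothing about it without uniqueness. Adding the subgradient inequalities at two minimisers bounds
  their squared distance by 0.\<close>

lemma prox_is_min:
  fixes f :: "'a::euclidean_space \<Rightarrow> real"
  assumes f: "convex_on UNIV f" and lam: "0 < lam"
  shows "f (prox lam f u) + 1 / (2 * lam) * (norm (u - prox lam f u))\<^sup>2
    \<le> f w + 1 / (2 * lam) * (norm (u - w))\<^sup>2"
proof -
  let ?q = "\<lambda>w. f w + 1 / (2 * lam) * (norm (u - w))\<^sup>2"
  obtain p where p: "\<And>w. ?q p \<le> ?q w"
    using prox_objective_attains_min[OF f lam] by blast
  have uniq: "w = p" if w: "\<And>y. ?q w \<le> ?q y" for w
  proof -
    have "f p + (1 / lam) *\<^sub>R (u - p) \<bullet> (w - p) \<le> f w" "f w + (1 / lam) *\<^sub>R (u - w) \<bullet> (p - w) \<le> f p"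
      using prox_objective_growth[OF f lam] p w by blast+
    then have "(1 / lam) *\<^sub>R (u - p) \<bullet> (w - p) + (1 / lam) *\<^sub>R (u - w) \<bullet> (p - w) \<le> 0"
      by simp
    also have "(1 / lam) *\<^sub>R (u - p) \<bullet> (w - p) + (1 / lam) *\<^sub>R (u - w) \<bullet> (p - w)
        = (1 / lam) * (norm (w - p))\<^sup>2"
      using lam by (simp add: power2_norm_eq_inner inner_diff inner_commute field_simps)
    finally have "(norm (w - p))\<^sup>2 \<le> 0" using lam by (simp add: divide_le_0_iff)
    then show ?thesis by simp
  qed
  have "prox lam f u = p"
    unfolding prox_def
  proof (rule the_equality)
    show "is_arg_min ?q (\<lambda>_. True) p"
      using p by (auto simp: is_arg_min_def not_less)
    show "w = p" if "is_arg_min ?q (\<lambda>_. True) w" for w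
      using that by (intro uniq) (auto simp: is_arg_min_def not_less)
  qed
  then show ?thesis using p by simp
qed

lemma moreau_env_eq:
  fixes f :: "'a::euclidean_space \<Rightarrow> real"
  assumes f: "convex_on UNIV f" and lam: "0 < lam"
  shows "moreau_env lam f u = f (prox lam f u) + 1 / (2 * lam) * (norm (u - prox lam f u))\<^sup>2"
  unfolding moreau_env_def
  by (rule cInf_eq_minimum) (use prox_is_min[OF f lam, of u] in auto)

lemma moreau_env_le:
  fixes f :: "'a::euclidean_space \<Rightarrow> real"
  assumes "convex_on UNIV f" "0 < lam"
  shows "moreau_env lam f u \<le> f w + 1 / (2 * lam) * (norm (u - w))\<^sup>2"
  using prox_is_min[OF assms] moreau_env_eq[OF assms] by simp

text \<open>The Yosida approximation of the subdifferential of \<open>f\<close>: for convex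
  \<open>f\<close> a subgradient of \<open>f\<close> at the proximal point and, as shown below, the
  gradient of the envelope at \<open>u\<close>.\<close>

definition moreau_grad :: "real \<Rightarrow> ('a::real_inner \<Rightarrow> real) \<Rightarrow> 'a \<Rightarrow> 'a" where
  "moreau_grad lam f u = (1 / lam) *\<^sub>R (u - prox lam f u)"

text \<open>The last term is what makes the gradient Lipschitz.\<close>

lemma moreau_env_lower:
  fixes f :: "'a::euclidean_space \<Rightarrow> real"
  assumes f: "convex_on UNIV f" and lam: "0 < lam"
  shows "moreau_env lam f u + moreau_grad lam f u \<bullet> (w - u)
      + lam / 2 * (norm (moreau_grad lam f w - moreau_grad lam f u))\<^sup>2 \<le> moreau_env lam f w"
proof -
  let ?g = "moreau_grad lam f"
  let ?p = "prox lam f"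
  have p: "?p v = v - lam *\<^sub>R ?g v" for v
    using lam by (simp add: moreau_grad_def)
  have e: "moreau_env lam f v = f (?p v) + lam / 2 * (norm (?g v))\<^sup>2" for v
  proof -
    have "v - ?p v = lam *\<^sub>R ?g v" using lam by (simp add: moreau_grad_def)
    then have "norm (v - ?p v) = lam * norm (?g v)" using lam by simp
    then show ?thesis using lam by (simp add: moreau_env_eq[OF f lam] power2_eq_square)
  qed
  have "f (?p u) + ?g u \<bullet> (?p w - ?p u) \<le> f (?p w)"
    unfolding moreau_grad_def by (rule prox_objective_growth[OF f lam prox_is_min[OF f lam]])
  moreover have "?p w - ?p u = (w - u) - lam *\<^sub>R (?g w - ?g u)"
    unfolding p[of w] p[of u] by (simp add: algebra_simps)
  then have "?g u \<bullet> (?p w - ?p u) = ?g u \<bullet> (w - u) - lam * (?g u \<bullet> ?g w) + lam * (?g u \<bullet> ?g u)"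
    by (simp only: inner_diff_right inner_scaleR_right) (simp add: algebra_simps)
  moreover have "lam / 2 * (norm (?g w - ?g u))\<^sup>2
      = lam / 2 * (norm (?g w))\<^sup>2 - lam * (?g u \<bullet> ?g w) + lam / 2 * (norm (?g u))\<^sup>2"
    by (simp add: power2_norm_eq_inner inner_diff inner_commute algebra_simps)
  moreover have "lam * (?g u \<bullet> ?g u) = lam / 2 * (norm (?g u))\<^sup>2 + lam / 2 * (norm (?g u))\<^sup>2"
    by (simp add: power2_norm_eq_inner)
  ultimately show ?thesis unfolding e by linarith
qed

text \<open>The proximal point of \<open>u\<close> is a competitor in the infimum at
  \<open>w\<close>; expanding the square around \<open>u\<close> gives the bound.\<close>

lemma moreau_env_upper:
  fixes f :: "'a::euclidean_space \<Rightarrow> real"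
  assumes f: "convex_on UNIV f" and lam: "0 < lam"
  shows "moreau_env lam f w \<le> moreau_env lam f u + moreau_grad lam f u \<bullet> (w - u)
      + 1 / (2 * lam) * (norm (w - u))\<^sup>2"
proof -
  have "w - prox lam f u = (w - u) + (u - prox lam f u)" by simp
  then have "(norm (w - prox lam f u))\<^sup>2
      = (norm (w - u))\<^sup>2 + 2 * ((u - prox lam f u) \<bullet> (w - u)) + (norm (u - prox lam f u))\<^sup>2"
    by (simp only: power2_norm_eq_inner inner_add inner_commute)
  then show ?thesis
    using moreau_env_le[OF f lam, of w "prox lam f u"] lam
    unfolding moreau_env_eq[OF f lam, of u] moreau_grad_def inner_scaleR_left
    by (simp add: field_simps)
qed

lemma moreau_env_subgradient:
  fixes f :: "'a::euclidean_space \<Rightarrow> real"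
  assumes "convex_on UNIV f" "0 < lam"
  shows "moreau_env lam f u + moreau_grad lam f u \<bullet> (w - u) \<le> moreau_env lam f w"
proof -
  have "0 \<le> lam / 2 * (norm (moreau_grad lam f w - moreau_grad lam f u))\<^sup>2"
    using \<open>0 < lam\<close> by simp
  then show ?thesis
    using moreau_env_lower[OF assms, of u w] by linarith
qed

lemma moreau_env_GDERIV:
  fixes f :: "'a::euclidean_space \<Rightarrow> real"
  assumes "convex_on UNIV f" "0 < lam"
  shows "GDERIV (moreau_env lam f) u :> moreau_grad lam f u"
proof (rule quadratic_bound_GDERIV)
  show "0 < 1 / (2 * lam)" using assms by simp
  show "\<bar>moreau_env lam f y - moreau_env lam f u - moreau_grad lam f u \<bullet> (y - u)\<bar>
        \<le> 1 / (2 * lam) * (norm (y - u))\<^sup>2" for y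
    using moreau_env_subgradient[OF assms, of u y] moreau_env_upper[OF assms, of y u] by simp
qed

text \<open>\<open>moreau_env_lower\<close> added to its mirror image gives cocoercivity of the
  gradient, which Cauchy-Schwarz turns into a Lipschitz bound.\<close>

lemma moreau_grad_lipschitz:
  fixes f :: "'a::euclidean_space \<Rightarrow> real"
  assumes "convex_on UNIV f" and lam: "0 < lam"
  shows "norm (moreau_grad lam f w - moreau_grad lam f u) \<le> 1 / lam * norm (w - u)"
proof -
  let ?g = "moreau_grad lam f"
  let ?n = "norm (?g w - ?g u)"
  have "?g u \<bullet> (w - u) + ?g w \<bullet> (u - w) = - ((?g w - ?g u) \<bullet> (w - u))"
    by (simp add: inner_diff algebra_simps)
  then have "lam * ?n\<^sup>2 \<le> (?g w - ?g u) \<bullet> (w - u)"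
    using moreau_env_lower[OF assms, of u w] moreau_env_lower[OF assms, of w u]
    by (simp add: norm_minus_commute)
  also have "\<dots> \<le> ?n * norm (w - u)" by (rule norm_cauchy_schwarz)
  finally have "?n * (lam * ?n) \<le> ?n * norm (w - u)" by (simp add: power2_eq_square algebra_simps)
  then show ?thesis
    using lam by (cases "?n = 0") (auto simp: field_simps)
qed

text \<open>Monotonicity makes the difference of the envelopes nonnegative, and it is zero at
  \<open>u\<close>, so its differential vanishes there.\<close>

lemma moreau_grad_eqI:
  fixes f F :: "'a::euclidean_space \<Rightarrow> real"
  assumes F: "convex_on UNIV F" and f: "convex_on UNIV f" and lam: "0 < lam"
    and le: "\<And>w. f w \<le> F w" and eq: "moreau_env lam f u = moreau_env lam F u"
  shows "moreau_grad lam F u = moreau_grad lam f u"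
proof -
  have mono: "moreau_env lam f w \<le> moreau_env lam F w" for w
    using moreau_env_le[OF f lam, of w "prox lam F w"] le[of "prox lam F w"]
    unfolding moreau_env_eq[OF F lam] by simp
  let ?D = "moreau_grad lam F u - moreau_grad lam f u"
  have "GDERIV (\<lambda>w. moreau_env lam F w - moreau_env lam f w) u :> ?D"
    by (intro GDERIV_diff moreau_env_GDERIV assms)
  then have "((\<lambda>w. moreau_env lam F w - moreau_env lam f w) has_derivative (\<lambda>h. h \<bullet> ?D)) (at u)"
    unfolding gderiv_def .
  from differential_zero_maxmin[OF UNIV_I open_UNIV this] mono eq
  have "(\<lambda>h. h \<bullet> ?D) = (\<lambda>v. 0)" by simp
  then have "?D \<bullet> ?D = 0" by (rule fun_cong)
  then show ?thesis by simp
qed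

subsection \<open>A minimax theorem and active vectors\<close>

text \<open>The values at the two points map \<open>C\<close> onto a compact convex set in the
  plane. If it missed the quadrant above \<open>\<alpha>\<close>, a separating line would provide
  weights, and at the correspondingly weighted mean of \<open>w1\<close> and \<open>w2\<close> no
  \<open>v\<close> could reach \<open>\<alpha>\<close>. The topology is an explicit \<open>T\<close>
  because weak-star is not the type class topology of the dual.\<close>

lemma minimax_two_points:
  fixes F :: "'v::real_vector \<Rightarrow> 'w::real_vector \<Rightarrow> real"
  assumes C: "convex C" "compactin T C"
    and cont: "\<And>w. continuous_map T euclidean (\<lambda>v. F v w)"
    and aff: "\<And>v v' s t w. 0 \<le> s \<Longrightarrow> 0 \<le> t \<Longrightarrow> s + t = 1 \<Longrightarrow> F (s *\<^sub>R v + t *\<^sub>R v') w = s * F v w + t * F v' w"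
    and conv: "\<And>v. v \<in> C \<Longrightarrow> convex_on UNIV (F v)"
    and ex: "\<And>w. \<exists>v\<in>C. \<alpha> \<le> F v w"
  shows "\<exists>v\<in>C. \<alpha> \<le> F v w1 \<and> \<alpha> \<le> F v w2"
proof (rule ccontr)
  assume neg: "\<not> ?thesis"
  define I where "I = (\<lambda>v. (F v w1, F v w2)) ` C"
  define Q where "Q = {\<alpha>..} \<times> {\<alpha>..}"
  have "continuous_map T (prod_topology euclidean euclidean) (\<lambda>v. (F v w1, F v w2))"
    by (intro continuous_map_pairedI cont)
  then have "compactin (prod_topology euclidean euclidean) I"
    unfolding I_def using C image_compactin by blast
  then have cI: "compact I" by simp
  have "convex I"
  proof (rule convexI)
    fix x y s t assume xy: "x \<in> I" "y \<in> I" and st: "0 \<le> (s::real)" "0 \<le> t" "s + t = 1"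
    obtain v v' where v: "v \<in> C" "x = (F v w1, F v w2)" "v' \<in> C" "y = (F v' w1, F v' w2)"
      using xy unfolding I_def by auto
    have "s *\<^sub>R x + t *\<^sub>R y = (\<lambda>v. (F v w1, F v w2)) (s *\<^sub>R v + t *\<^sub>R v')"
      using v st aff by simp
    then show "s *\<^sub>R x + t *\<^sub>R y \<in> I"
      unfolding I_def using convexD[OF C(1)] v st by blast
  qed
  moreover have "I \<noteq> {}" using ex I_def by auto
  moreover have "convex Q" "closed Q"
    unfolding Q_def by (auto intro: convex_Times closed_Times)
  moreover have "I \<inter> Q = {}" using neg by (auto simp: I_def Q_def)
  ultimately have "\<exists>a b. (\<forall>x\<in>I. a \<bullet> x < b) \<and> (\<forall>x\<in>Q. b < a \<bullet> x)"
    using cI separating_hyperplane_compact_closed[of I Q] by blast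
  then obtain a b where ab: "\<forall>x\<in>I. a \<bullet> x < b" "\<forall>x\<in>Q. b < a \<bullet> x"
    by blast
  obtain a1 a2 where "a = (a1, a2)" by (cases a)
  with ab have I: "\<And>x. x \<in> I \<Longrightarrow> (a1, a2) \<bullet> x < b" and Q: "\<And>x. x \<in> Q \<Longrightarrow> b < (a1, a2) \<bullet> x"
    by auto
  have Q': "b < a1 * x + a2 * y" if "\<alpha> \<le> x" "\<alpha> \<le> y" for x y
    using Q[of "(x, y)"] that by (simp add: Q_def)
  have I': "a1 * F v w1 + a2 * F v w2 < b" if "v \<in> C" for v
    using I[of "(F v w1, F v w2)"] that by (auto simp: I_def)
  \<comment> \<open>The quadrant is unbounded in each coordinate direction, so a functional bounded
    below on it has nonnegative coefficients.\<close>
  have sgn: "0 \<le> c" if c: "\<And>x. \<alpha> \<le> x \<Longrightarrow> b < c * x + d" for c d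
  proof (rule ccontr)
    assume "\<not> 0 \<le> c"
    then have "c < 0" by simp
    define x where "x = max \<alpha> ((b - d) / c)"
    have "c * x \<le> c * ((b - d) / c)" unfolding x_def
      using \<open>c < 0\<close> by (intro mult_left_mono_neg) auto
    moreover have "\<alpha> \<le> x" by (simp add: x_def)
    ultimately show False using c[of x] \<open>c < 0\<close> by simp
  qed
  have a: "0 \<le> a1" "0 \<le> a2"
    using sgn[of a1 "a2 * \<alpha>"] sgn[of a2 "a1 * \<alpha>"] Q' by (auto simp: add.commute)
  have "C \<noteq> {}" using ex by auto
  have "a1 + a2 \<noteq> 0"
  proof
    assume "a1 + a2 = 0"
    then have "a1 = 0" "a2 = 0" using a by auto
    then show False using Q'[of \<alpha> \<alpha>] I' \<open>C \<noteq> {}\<close> by auto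
  qed
  then have s: "0 < a1 + a2" using a by simp
  \<comment> \<open>The normal of the separating line, scaled to sum 1, gives the test point that
    contradicts \<open>ex\<close>.\<close>
  define w where "w = (a1 / (a1 + a2)) *\<^sub>R w1 + (a2 / (a1 + a2)) *\<^sub>R w2"
  obtain v where v: "v \<in> C" "\<alpha> \<le> F v w" using ex by blast
  have "F v w \<le> a1 / (a1 + a2) * F v w1 + a2 / (a1 + a2) * F v w2"
  proof -
    have "0 \<le> a1 / (a1 + a2)" "0 \<le> a2 / (a1 + a2)" using a s by auto
    moreover have "a1 / (a1 + a2) + a2 / (a1 + a2) = 1"
      using s by (simp add: add_divide_distrib[symmetric])
    ultimately show ?thesis
      unfolding w_def using conv[OF v(1)] by (simp only: convex_on_def UNIV_I Ball_def simp_thms)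
  qed
  also have "\<dots> = (a1 * F v w1 + a2 * F v w2) / (a1 + a2)"
    by (simp add: add_divide_distrib)
  finally have "(a1 + a2) * F v w \<le> a1 * F v w1 + a2 * F v w2"
    using s by (simp add: field_simps)
  moreover have "(a1 + a2) * \<alpha> \<le> (a1 + a2) * F v w"
    using s v by simp
  ultimately show False
    using I'[OF v(1)] Q'[of \<alpha> \<alpha>] by (simp add: algebra_simps)
qed

text \<open>The induction shrinks \<open>C\<close> to the \<open>v\<close> that are good for
  \<open>w0\<close>. This set is again convex and compact, and \<open>ex\<close> for it is exactly
  the two-point case; hence \<open>C\<close> is arbitrary in the induction.\<close>

lemma minimax_finite:
  fixes F :: "'v::real_vector \<Rightarrow> 'w::real_vector \<Rightarrow> real"
  assumes W: "finite W" and C: "convex C" "compactin T C"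
    and cont: "\<And>w. continuous_map T euclidean (\<lambda>v. F v w)"
    and aff: "\<And>v v' s t w. 0 \<le> s \<Longrightarrow> 0 \<le> t \<Longrightarrow> s + t = 1 \<Longrightarrow> F (s *\<^sub>R v + t *\<^sub>R v') w = s * F v w + t * F v' w"
    and conv: "\<And>v. v \<in> C \<Longrightarrow> convex_on UNIV (F v)"
    and ex: "\<And>w. \<exists>v\<in>C. \<alpha> \<le> F v w"
  shows "\<exists>v\<in>C. \<forall>w\<in>W. \<alpha> \<le> F v w"
  using W C conv ex
proof (induction W arbitrary: C rule: finite_induct)
  case empty
  then show ?case by auto
next
  case (insert w0 W)
  define C' where "C' = {v \<in> C. \<alpha> \<le> F v w0}"
  have "convex C'"
  proof (rule convexI)
    fix x y s t assume xy: "x \<in> C'" "y \<in> C'" and st: "0 \<le> (s::real)" "0 \<le> t" "s + t = 1"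
    have "\<alpha> \<le> s * F x w0 + t * F y w0"
      using convex_bound_le[of "- F x w0" "- \<alpha>" "- F y w0" s t] xy st by (simp add: C'_def)
    then show "s *\<^sub>R x + t *\<^sub>R y \<in> C'"
      using xy st insert.prems(1) aff by (auto simp: C'_def convexD)
  qed
  moreover have "closedin T {v \<in> topspace T. F v w0 \<in> {\<alpha>..}}"
    using cont by (rule closedin_continuous_map_preimage) simp
  then have "compactin T (C \<inter> {v \<in> topspace T. F v w0 \<in> {\<alpha>..}})"
    using insert.prems(2) by (simp add: compact_Int_closedin)
  moreover have "C \<inter> {v \<in> topspace T. F v w0 \<in> {\<alpha>..}} = C'"
    using compactin_subset_topspace[OF insert.prems(2)] by (auto simp: C'_def)
  moreover have "\<exists>v\<in>C'. \<alpha> \<le> F v w" for w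
  proof -
    have "\<exists>v\<in>C. \<alpha> \<le> F v w0 \<and> \<alpha> \<le> F v w"
      by (rule minimax_two_points[where F = F and T = T]) (fact insert.prems cont aff)+
    then show ?thesis unfolding C'_def by blast
  qed
  moreover have "convex_on UNIV (F v)" if "v \<in> C'" for v
    using insert.prems(3) that by (auto simp: C'_def)
  ultimately obtain v where "v \<in> C'" "\<forall>w\<in>W. \<alpha> \<le> F v w"
    using insert.IH[of C'] by auto
  then show ?case by (auto simp: C'_def)
qed

text \<open>The superlevel sets belonging to single points \<open>w\<close> are closed, and the
  finite case is their finite intersection property inside \<open>C\<close>.\<close>

lemma minimax_compact:
  fixes F :: "'v::real_vector \<Rightarrow> 'w::real_vector \<Rightarrow> real"
  assumes C: "convex C" "compactin T C"
    and cont: "\<And>w. continuous_map T euclidean (\<lambda>v. F v w)"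
    and aff: "\<And>v v' s t w. 0 \<le> s \<Longrightarrow> 0 \<le> t \<Longrightarrow> s + t = 1 \<Longrightarrow> F (s *\<^sub>R v + t *\<^sub>R v') w = s * F v w + t * F v' w"
    and conv: "\<And>v. v \<in> C \<Longrightarrow> convex_on UNIV (F v)"
    and ex: "\<And>w. \<exists>v\<in>C. \<alpha> \<le> F v w"
  shows "\<exists>v\<in>C. \<forall>w. \<alpha> \<le> F v w"
proof -
  define c where "c w = {v \<in> topspace T. F v w \<in> {\<alpha>..}}" for w
  have sub: "C \<subseteq> topspace T" using C compactin_subset_topspace by blast
  have cl: "closedin T (c w)" for w
    unfolding c_def using cont by (rule closedin_continuous_map_preimage) simp
  have fip: "C \<inter> \<Inter> \<F> \<noteq> {}" if "finite \<F>" "\<F> \<subseteq> range c" for \<F>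
  proof -
    have "\<exists>W\<subseteq>UNIV. finite W \<and> \<F> = c ` W"
      using that by (rule finite_subset_image)
    then obtain W where W: "finite W" "\<F> = c ` W" by blast
    obtain v where "v \<in> C" "\<forall>w\<in>W. \<alpha> \<le> F v w"
      using minimax_finite[where F = F and T = T, OF W(1) C cont aff conv ex] by blast
    then have "v \<in> C \<inter> \<Inter> \<F>" using sub W by (auto simp: c_def)
    then show ?thesis by blast
  qed
  have "C \<inter> \<Inter> (range c) \<noteq> {}"
    using C(2) cl fip unfolding compactin_fip by blast
  then show ?thesis by (auto simp: c_def)
qed

section \<open>Suprema over a weak-star compact set of functionals\<close>

lemma weak_star_evaluation_attains_max:
  assumes "compactin weak_star C" "C \<noteq> {}"
  shows "\<exists>v\<in>C. \<forall>v'\<in>C. blinfun_apply v' y \<le> blinfun_apply v y"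
proof -
  have "compactin euclidean ((\<lambda>v. blinfun_apply v y) ` C)"
    using image_compactin[OF assms(1) strong_operator_topology_continuous_evaluation] .
  then have "compact ((\<lambda>v. blinfun_apply v y) ` C)" by simp
  then show ?thesis
    using assms(2) compact_attains_sup[of "(\<lambda>v. blinfun_apply v y) ` C"] by simp
qed

locale compact_scalarisation =
  fixes C :: "('y::real_normed_vector \<Rightarrow>\<^sub>L real) set"
    and \<Phi> :: "'h::euclidean_space \<times> 'z::euclidean_space \<Rightarrow> 'y"
    and h :: "'h \<Rightarrow> real" and lam :: real
  assumes compact: "compactin weak_star C" and convex: "convex C" and nonempty: "C \<noteq> {}"
    and convex_scalarised: "\<And>v. v \<in> C \<Longrightarrow> convex_on UNIV (scalarised \<Phi> h v)"
    and lam_pos: "0 < lam"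
begin

text \<open>Evaluation is weak-star continuous, so compactness turns the real-valued
  \<open>SUP\<close> into a maximum and no question of unboundedness arises.\<close>

lemma sup_attained: "\<exists>v\<in>C. sup_scalarised C \<Phi> h u = scalarised \<Phi> h v u"
  and scalarised_le_sup: "v \<in> C \<Longrightarrow> scalarised \<Phi> h v u \<le> sup_scalarised C \<Phi> h u"
proof -
  obtain v0 where v0: "v0 \<in> C" "\<And>v'. v' \<in> C \<Longrightarrow> scalarised \<Phi> h v' u \<le> scalarised \<Phi> h v0 u"
    using weak_star_evaluation_attains_max[OF compact nonempty, of "\<Phi> u"]
    unfolding scalarised_def by auto
  have "sup_scalarised C \<Phi> h u = scalarised \<Phi> h v0 u"
    unfolding sup_scalarised_def by (rule cSup_eq_maximum) (use v0 in auto)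
  then show "\<exists>v\<in>C. sup_scalarised C \<Phi> h u = scalarised \<Phi> h v u"
    "v \<in> C \<Longrightarrow> scalarised \<Phi> h v u \<le> sup_scalarised C \<Phi> h u"
    using v0 by auto
qed

lemma convex_sup: "convex_on UNIV (sup_scalarised C \<Phi> h)"
proof (rule convex_onI)
  fix t :: real and x y :: "'h \<times> 'z" assume t: "0 < t" "t < 1"
  let ?z = "(1 - t) *\<^sub>R x + t *\<^sub>R y"
  obtain v where v: "v \<in> C" "sup_scalarised C \<Phi> h ?z = scalarised \<Phi> h v ?z"
    using sup_attained by blast
  have "scalarised \<Phi> h v ?z \<le> (1 - t) * scalarised \<Phi> h v x + t * scalarised \<Phi> h v y"
    using convex_scalarised[OF v(1)] t by (intro convex_onD) auto
  also have "\<dots> \<le> (1 - t) * sup_scalarised C \<Phi> h x + t * sup_scalarised C \<Phi> h y"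
    using t v by (intro add_mono mult_left_mono scalarised_le_sup) auto
  finally show "sup_scalarised C \<Phi> h ?z \<le> (1 - t) * sup_scalarised C \<Phi> h x + t * sup_scalarised C \<Phi> h y"
    using v by simp
qed simp

text \<open>Minimax for \<open>?F\<close> with the envelope value as the level: for each single
  \<open>w\<close> a maximiser of the supremum at \<open>w\<close> reaches it, hence one
  \<open>v\<close> reaches it for all \<open>w\<close>, and the envelope of that \<open>v\<close> is
  not smaller. The reverse inequality is monotonicity.\<close>

lemma active_exists:
  "\<exists>v\<in>C. moreau_env lam (scalarised \<Phi> h v) u = moreau_env lam (sup_scalarised C \<Phi> h) u"
proof -
  let ?q = "\<lambda>w. 1 / (2 * lam) * (norm (u - w))\<^sup>2"
  let ?F = "\<lambda>v w. scalarised \<Phi> h v w + ?q w"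
  let ?S = "sup_scalarised C \<Phi> h"
  have q: "convex_on UNIV ?q"
  proof (rule convex_onI)
    fix t :: real and x y assume t: "0 < t" "t < 1"
    have "u - ((1 - t) *\<^sub>R x + t *\<^sub>R y) = (u - x) - t *\<^sub>R (y - x)" by (simp add: algebra_simps)
    moreover have "u - y = (u - x) - 1 *\<^sub>R (y - x)" by simp
    moreover have "0 \<le> t * (1 - t) * (norm (y - x))\<^sup>2" using t by simp
    ultimately have "(norm (u - ((1 - t) *\<^sub>R x + t *\<^sub>R y)))\<^sup>2 \<le> (1 - t) * (norm (u - x))\<^sup>2 + t * (norm (u - y))\<^sup>2"
      by (simp only: norm_diff_scaleR_sq) (simp add: algebra_simps power2_eq_square)
    then have "1 / (2 * lam) * (norm (u - ((1 - t) *\<^sub>R x + t *\<^sub>R y)))\<^sup>2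
        \<le> 1 / (2 * lam) * ((1 - t) * (norm (u - x))\<^sup>2 + t * (norm (u - y))\<^sup>2)"
      using lam_pos by (intro mult_left_mono) auto
    then show "?q ((1 - t) *\<^sub>R x + t *\<^sub>R y) \<le> (1 - t) * ?q x + t * ?q y"
      by (simp add: distrib_left mult.left_commute)
  qed simp
  have "\<exists>v\<in>C. \<forall>w. moreau_env lam ?S u \<le> ?F v w"
  proof (rule minimax_compact[where F = ?F and T = weak_star, OF convex compact])
    show "continuous_map weak_star euclidean (\<lambda>v. ?F v w)" for w
      unfolding scalarised_def
      by (intro continuous_map_add strong_operator_topology_continuous_evaluation) auto
    show "convex_on UNIV (?F v)" if "v \<in> C" for v
      by (intro convex_on_add convex_scalarised that q)
    show "\<exists>v\<in>C. moreau_env lam ?S u \<le> ?F v w" for w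
      using sup_attained[of w] moreau_env_le[OF convex_sup lam_pos, of u w] by auto
    \<comment> \<open>\<open>h\<close> and the quadratic do not depend on \<open>v\<close>, so
      \<open>?F\<close> is affine but not linear in \<open>v\<close> and the weights have to sum to
      1.\<close>
    show "?F (s *\<^sub>R v + t *\<^sub>R v') w = s * ?F v w + t * ?F v' w" if "s + t = 1" for s t v v' w
    proof -
      have "s * (h (fst w) + ?q w) + t * (h (fst w) + ?q w) = h (fst w) + ?q w"
        using that by (metis distrib_right mult_1)
      then show ?thesis
        by (simp add: scalarised_def blinfun.add_left blinfun.scaleR_left distrib_left)
    qed
  qed
  then obtain v where v: "v \<in> C" "\<And>w. moreau_env lam ?S u \<le> ?F v w" by blast
  have "moreau_env lam ?S u \<le> moreau_env lam (scalarised \<Phi> h v) u"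
    unfolding moreau_env_eq[OF convex_scalarised[OF v(1)] lam_pos] by (rule v(2))
  moreover have "moreau_env lam (scalarised \<Phi> h v) u \<le> moreau_env lam ?S u"
    using moreau_env_le[OF convex_scalarised[OF v(1)] lam_pos, of u "prox lam ?S u"]
      scalarised_le_sup[OF v(1), of "prox lam ?S u"]
    unfolding moreau_env_eq[OF convex_sup lam_pos] by simp
  ultimately show ?thesis using v(1) by force
qed

lemma active_GDERIV:
  assumes "v \<in> C" "moreau_env lam (scalarised \<Phi> h v) u = moreau_env lam (sup_scalarised C \<Phi> h) u"
  shows "GDERIV (moreau_env lam (sup_scalarised C \<Phi> h)) u :>
    (1 / lam) *\<^sub>R (u - prox lam (scalarised \<Phi> h v) u)"
proof -
  have "moreau_grad lam (sup_scalarised C \<Phi> h) u = moreau_grad lam (scalarised \<Phi> h v) u"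
    using assms convex_scalarised scalarised_le_sup
    by (intro moreau_grad_eqI convex_sup lam_pos) auto
  then show ?thesis
    using moreau_env_GDERIV[OF convex_sup lam_pos, of u] by (simp only: moreau_grad_def)
qed

end

subsection \<open>Linear change of variables\<close>

text \<open>The predicate for the induction over elementary linear maps. On Lebesgue measurable sets
  of finite measure it makes sense for singular maps too, and it is stable under
  composition.\<close>

definition scales_by_det :: "(real^'n \<Rightarrow> real^'n) \<Rightarrow> bool" where
  "scales_by_det f \<longleftrightarrow> (\<forall>S\<in>lmeasurable. f ` S \<in> lmeasurable \<and>
     measure lebesgue (f ` S) = \<bar>det (matrix f)\<bar> * measure lebesgue S)"

lemma scales_by_detI:
  fixes f :: "real^'n \<Rightarrow> real^'n"
  assumes "linear f" "\<bar>det (matrix f)\<bar> = 1"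
    and "\<And>a b. cbox a b \<noteq> {} \<Longrightarrow> measure lebesgue (f ` cbox a b) = measure lebesgue (cbox a b)"
  shows "scales_by_det f"
proof -
  have "measure lebesgue (f ` cbox a b) = 1 * measure lebesgue (cbox a b)" for a b
  proof (cases "cbox a b = {}")
    case False
    then show ?thesis using assms(3) by simp
  qed (simp only: image_empty measure_empty mult_1)
  then have "f ` S \<in> lmeasurable \<and> measure lebesgue (f ` S) = 1 * measure lebesgue S"
    if "S \<in> lmeasurable" for S
    using measure_linear_sufficient[OF assms(1) that, of 1] by metis
  then show ?thesis
    unfolding scales_by_det_def assms(2) by blast
qed

text \<open>A swap of coordinates is an involution that maps boxes to boxes and merely permutes
  their side lengths.\<close>

lemma scales_by_det_swap:
  fixes m n :: "'n::finite"
  shows "scales_by_det (\<lambda>x::real^'n. \<chi> i. x $ Transposition.transpose m n i)"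
proof (rule scales_by_detI)
  let ?\<tau> = "Transposition.transpose m n"
  let ?f = "\<lambda>x::real^'n. \<chi> i. x $ ?\<tau> i"
  show "linear ?f" by (rule linearI) (simp_all add: vec_eq_iff)
  have "matrix ?f = (\<chi> i. mat 1 $ ?\<tau> i)"
    by (simp add: vec_eq_iff matrix_def mat_def axis_def)
  then show "\<bar>det (matrix ?f)\<bar> = 1"
    by (simp add: det_permute_rows permutes_swap_id sign_swap_id abs_mult)
  fix a b :: "real^'n" assume ne: "cbox a b \<noteq> {}"
  have inv: "?f (?f x) = x" for x by (simp add: vec_eq_iff)
  have mem: "?f x \<in> cbox (?f a) (?f b)" if "x \<in> cbox a b" for x a b
    using that by (simp add: mem_box_cart)
  have "?f ` cbox a b = cbox (?f a) (?f b)"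
  proof
    show "cbox (?f a) (?f b) \<subseteq> ?f ` cbox a b"
    proof
      fix y assume "y \<in> cbox (?f a) (?f b)"
      then have "?f y \<in> cbox a b" using mem[of y "?f a" "?f b"] by (simp only: inv)
      then show "y \<in> ?f ` cbox a b" by (rule image_eqI[rotated]) (simp only: inv)
    qed
  qed (use mem in blast)
  moreover have "cbox (?f a) (?f b) \<noteq> {}" using ne mem by blast
  moreover have "(\<Prod>i\<in>UNIV. b $ ?\<tau> i - a $ ?\<tau> i) = (\<Prod>i\<in>UNIV. b $ i - a $ i)"
  proof -
    have "?\<tau> permutes UNIV" by (simp add: permutes_swap_id)
    from prod.permute[OF this, of "\<lambda>i. b $ i - a $ i"] show ?thesis by (simp add: o_def)
  qed
  ultimately show "measure lebesgue (?f ` cbox a b) = measure lebesgue (cbox a b)"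
    using ne by (simp add: content_cbox_cart)
qed

lemma scales_by_det_shear:
  fixes m n :: "'n::finite"
  assumes "m \<noteq> n"
  shows "scales_by_det (\<lambda>x::real^'n. \<chi> i. if i = m then x $ m + x $ n else x $ i)"
proof (rule scales_by_detI)
  let ?f = "\<lambda>x::real^'n. \<chi> i. if i = m then x $ m + x $ n else x $ i"
  show lin: "linear ?f" by (rule linearI) (simp_all add: vec_eq_iff algebra_simps)
  have "matrix ?f = (\<chi> k. if k = m then row m (mat 1) + 1 *s row n (mat 1) else row k (mat 1))"
    by (auto simp: vec_eq_iff matrix_def mat_def axis_def row_def)
  then show "\<bar>det (matrix ?f)\<bar> = 1"
    by (simp only: det_row_operation[OF assms]) simp
  fix a b :: "real^'n" assume ne: "cbox a b \<noteq> {}"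
  \<comment> \<open>Moving the lower corner to the origin meets the sign condition of
    \<open>measure_shear_interval\<close>.\<close>
  have shift: "cbox a b = (+) a ` cbox 0 (b - a)"
    by (simp add: cbox_translation[symmetric])
  have "?f ` cbox a b = (+) (?f a) ` ?f ` cbox 0 (b - a)"
    unfolding shift image_image using linear_add[OF lin] by simp
  then have "measure lebesgue (?f ` cbox a b) = measure lebesgue (?f ` cbox 0 (b - a))"
    by (simp only: measure_translation)
  also have "\<dots> = measure lebesgue (cbox 0 (b - a))"
    using ne shift by (intro measure_shear_interval assms) auto
  also have "\<dots> = measure lebesgue (cbox a b)"
    by (simp only: shift measure_translation)
  finally show "measure lebesgue (?f ` cbox a b) = measure lebesgue (cbox a b)" .
qed

text \<open>The library has this only for index types of class \<open>wellorder\<close>.\<close>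

lemma linear_scales_by_det:
  fixes f :: "real^'n \<Rightarrow> real^'n"
  assumes "linear f"
  shows "scales_by_det f"
  using assms
proof (rule induct_linear_elementary)
  show "scales_by_det (f \<circ> g)" if "linear f" "linear g" "scales_by_det f" "scales_by_det g" for f g :: "real^'n \<Rightarrow> real^'n"
    using that(3,4) unfolding scales_by_det_def matrix_compose[OF that(2,1)] image_comp[symmetric] det_mul abs_mult
    by simp
  show "scales_by_det f" if f: "linear f" "\<And>x. f x $ i = 0" for f :: "real^'n \<Rightarrow> real^'n" and i
  proof -
    have "\<not> surj f"
    proof
      assume "surj f"
      then obtain x where "f x = axis i 1" by (metis surjD)
      then show False using f(2)[of x] by simp
    qed
    then have "\<not> inj f" using f(1) linear_injective_imp_surjective by blast
    then have "det (matrix f) = 0" "negligible (f ` S)" for S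
      using f(1) det_nz_iff_inj negligible_linear_singular_image by blast+
    then show ?thesis
      unfolding scales_by_det_def
      by (simp add: negligible_imp_measure0 negligible_imp_measurable)
  qed
  show "scales_by_det (\<lambda>x::real^'n. \<chi> i. c i * x $ i)" for c
    unfolding scales_by_det_def
    by (simp add: measurable_stretch measure_stretch matrix_def axis_def det_diagonal)
qed (auto intro: scales_by_det_swap scales_by_det_shear)

text \<open>Boxes determine Lebesgue measure, which reduces the claim to the preimage of a box,
  whose image under \<open>L\<close> is the box itself. As an identity of measures it substitutes
  \<open>L *v z\<close> for \<open>z\<close> in an integral.\<close>

lemma lborel_eq_linear_image:
  fixes L :: "real^'n^'n"
  assumes "invertible L"
  shows "lborel = density (distr lborel borel ((*v) L)) (\<lambda>_. ennreal \<bar>det L\<bar>)"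
proof (rule lborel_eqI)
  fix l u :: "real^'n" assume lu: "\<And>b. b \<in> Basis \<Longrightarrow> l \<bullet> b \<le> u \<bullet> b"
  obtain L' where L': "L ** L' = mat 1" "L' ** L = mat 1"
    using assms unfolding invertible_def by blast
  have inv: "L *v (L' *v x) = x" "L' *v (L *v x) = x" for x
    using L' by (simp_all add: matrix_vector_mul_assoc)
  let ?P = "(*v) L -` box l u"
  have P: "?P = (*v) L' ` box l u"
    by (auto simp: inv image_iff intro!: bexI[of _ "L *v _"])
  have "scales_by_det ((*v) L')" "scales_by_det ((*v) L)"
    by (intro linear_scales_by_det matrix_vector_mul_linear)+
  then have Plm: "?P \<in> lmeasurable" and sc: "measure lebesgue ((*v) L ` ?P) = \<bar>det L\<bar> * measure lebesgue ?P"
    unfolding scales_by_det_def P by auto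
  have meas: "(*v) L \<in> borel_measurable borel"
    by (intro borel_measurable_continuous_onI matrix_vector_mult_linear_continuous_on)
  then have Pb: "?P \<in> sets borel"
    using measurable_sets[of "(*v) L" borel borel "box l u"] by simp
  have "(*v) L ` ?P = box l u"
    unfolding P by (simp add: image_image inv)
  then have eq: "measure lborel (box l u) = \<bar>det L\<bar> * measure lborel ?P"
    using sc Pb by (simp only: measure_completion sets_lborel borel_open open_box)
  have bdd: "bounded ?P"
    unfolding P by (intro bounded_linear_image) (auto simp: bounded_box)
  have "emeasure (density (distr lborel borel ((*v) L)) (\<lambda>_. ennreal \<bar>det L\<bar>)) (box l u)
      = ennreal \<bar>det L\<bar> * emeasure lborel ?P"
    using meas by (simp add: emeasure_density nn_integral_cmult_indicator emeasure_distr)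
  also have "\<dots> = ennreal \<bar>det L\<bar> * ennreal (measure lborel ?P)"
    using bdd Pb emeasure_bounded_finite[OF bdd] by (subst emeasure_eq_ennreal_measure) auto
  also have "\<dots> = ennreal (measure lborel (box l u))"
    by (simp add: eq ennreal_mult)
  also have "\<dots> = (\<Prod>b\<in>Basis. (u - l) \<bullet> b)"
    using lu by (simp add: measure_lborel_box_eq)
  finally show "emeasure (density (distr lborel borel ((*v) L)) (\<lambda>_. ennreal \<bar>det L\<bar>)) (box l u) = (\<Prod>b\<in>Basis. (u - l) \<bullet> b)" .
qed simp

subsection \<open>Polar coordinates\<close>

text \<open>Surface area of the sphere of radius \<open>r\<close>, the derivative of the volume of
  the ball. The \<open>itself\<close> argument carries the dimension.\<close>

definition radial_weight :: "'a::euclidean_space itself \<Rightarrow> real \<Rightarrow> real" where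
  "radial_weight _ r = real DIM('a) * unit_ball_vol DIM('a) * r ^ (DIM('a) - 1)"

lemma measurable_sgn_euclidean [measurable]:
  "sgn \<in> borel_measurable (borel :: 'a::euclidean_space measure)"
  unfolding sgn_div_norm by simp

lemma sets_sphere_uniform:
  "sets (sphere_uniform :: 'a::euclidean_space measure) = sets (restrict_space borel (sphere 0 1))"
  unfolding sphere_uniform_def by (simp add: sets_restrict_space)

lemma sphere_uniform_measurableD:
  assumes "B \<in> sets (sphere_uniform :: 'a::euclidean_space measure)"
  shows "B \<in> sets borel" "B \<subseteq> sphere 0 1"
  using assms unfolding sets_sphere_uniform
  by (auto simp: sets_restrict_space_iff sets_restrict_space)

text \<open>Undoes the normalisation of the uniform measure, so that the measure of \<open>B\<close>
  becomes the volume of the sector over \<open>B\<close>.\<close>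

lemma emeasure_sphere_uniform:
  fixes B :: "'a::euclidean_space set"
  assumes "B \<in> sets sphere_uniform"
  shows "emeasure sphere_uniform B * ennreal (unit_ball_vol DIM('a)) = emeasure lborel {z. norm z < 1 \<and> sgn z \<in> B}"
proof -
  note B = sphere_uniform_measurableD[OF assms]
  have [measurable]: "B \<in> sets borel" by (fact B)
  let ?u = "uniform_measure lborel (ball 0 1) :: 'a measure"
  have "emeasure sphere_uniform B = emeasure (distr ?u borel sgn) B"
    unfolding sphere_uniform_def using B by (subst emeasure_restrict_space) auto
  also have "\<dots> = emeasure ?u (sgn -` B)"
    by (subst emeasure_distr) auto
  also have "\<dots> = emeasure lborel (ball 0 1 \<inter> sgn -` B) / emeasure lborel (ball 0 1 :: 'a set)"
    using measurable_sets[OF measurable_sgn_euclidean, of B] by (subst emeasure_uniform_measure) auto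
  also have "ball 0 1 \<inter> sgn -` B = {z. norm z < 1 \<and> sgn z \<in> B}" by auto
  also have "emeasure lborel (ball 0 1 :: 'a set) = ennreal (unit_ball_vol DIM('a))"
    by (simp add: emeasure_ball)
  finally have "emeasure sphere_uniform B
      = emeasure lborel {z. norm z < 1 \<and> sgn z \<in> B} / ennreal (unit_ball_vol DIM('a))" .
  moreover have "0 < unit_ball_vol (real DIM('a))" by simp
  ultimately show ?thesis
    by (simp add: ennreal_divide_times divide_ennreal del: unit_ball_vol_pos)
qed

text \<open>\<open>sgn\<close> is invariant under positive scaling, so the sector of radius
  \<open>R\<close> is a dilation of the unit sector.\<close>

lemma emeasure_lborel_cone_scale:
  fixes B :: "'a::euclidean_space set"
  assumes B: "B \<in> sets borel" and R: "0 < R"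
  shows "emeasure lborel {z. norm z < R \<and> sgn z \<in> B} = ennreal (R ^ DIM('a)) * emeasure lborel {z. norm z < 1 \<and> sgn z \<in> B}"
proof -
  have [measurable]: "B \<in> sets borel" by (fact B)
  let ?X = "\<lambda>R. {z::'a. norm z < R \<and> sgn z \<in> B}"
  have X: "?X R \<in> sets borel" for R by measurable
  have "emeasure lborel (?X R) = emeasure (density (distr lborel borel (\<lambda>x. 0 + R *\<^sub>R x)) (\<lambda>_. \<bar>R\<bar> ^ DIM('a))) (?X R)"
    using R by (subst lborel_affine[of R 0]) auto
  also have "\<dots> = ennreal (R ^ DIM('a)) * emeasure lborel ((\<lambda>x. 0 + R *\<^sub>R x) -` ?X R)"
    using R X by (simp add: emeasure_density nn_integral_cmult_indicator emeasure_distr ennreal_power)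
  also have "(\<lambda>x. 0 + R *\<^sub>R x) -` ?X R = ?X 1"
    using R by (auto simp: sgn_scaleR)
  finally show ?thesis .
qed

text \<open>The volume of the ball is an antiderivative of the weight; \<open>max 0\<close> covers
  negative \<open>x\<close>, where both sides vanish because the dimension is positive.\<close>

lemma emeasure_radial:
  "emeasure (density lborel (\<lambda>r. ennreal (radial_weight TYPE('a::euclidean_space) r) * indicator {0..} r)) {..<x}
    = ennreal (unit_ball_vol DIM('a) * max 0 x ^ DIM('a))"
proof -
  let ?w = "radial_weight TYPE('a)"
  have w[measurable]: "?w \<in> borel_measurable borel"
    unfolding radial_weight_def by measurable
  have "emeasure (density lborel (\<lambda>r. ennreal (?w r) * indicator {0..} r)) {..<x}
      = (\<integral>\<^sup>+r. ennreal (?w r) * indicator {0..} r * indicator {..<x} r \<partial>lborel)"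
    by (subst emeasure_density) auto
  also have "\<dots> = (\<integral>\<^sup>+r. ennreal (?w r) * indicator {0..x} r \<partial>lborel)"
    by (rule nn_integral_cong_AE)
      (use AE_lborel_singleton[of x] in eventually_elim, auto split: split_indicator)
  also have "\<dots> = ennreal (unit_ball_vol DIM('a) * max 0 x ^ DIM('a))"
  proof (cases "0 \<le> x")
    case True
    have "(\<integral>\<^sup>+r. ennreal (?w r) * indicator {0..x} r \<partial>lborel)
        = unit_ball_vol DIM('a) * x ^ DIM('a) - unit_ball_vol DIM('a) * 0 ^ DIM('a)"
    proof (rule nn_integral_FTC_Icc)
      show "((\<lambda>x. unit_ball_vol DIM('a) * x ^ DIM('a)) has_real_derivative ?w r) (at r)" for r
        unfolding radial_weight_def by (auto intro!: derivative_eq_intros)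
    qed (use True in \<open>auto simp: radial_weight_def\<close>)
    then show ?thesis using True by simp
  qed simp
  finally show ?thesis .
qed

text \<open>For fixed \<open>B\<close> both sides are measures in \<open>A\<close>. The scaling of
  sectors makes them agree on the half-lines \<open>{..<x}\<close>, an intersection-stable generator
  of the Borel sets on which both are finite.\<close>

lemma emeasure_polar_rectangle:
  fixes B :: "'a::euclidean_space set"
  assumes A: "A \<in> sets borel" and B: "B \<in> sets sphere_uniform"
  shows "emeasure (density lborel (\<lambda>r. ennreal (radial_weight TYPE('a) r) * indicator {0..} r)) A * emeasure sphere_uniform B
    = emeasure lborel {z. norm z \<in> A \<and> sgn z \<in> B}"
proof -
  have [measurable]: "B \<in> sets borel" by (rule sphere_uniform_measurableD[OF B])
  let ?w = "radial_weight TYPE('a)"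
  have w[measurable]: "?w \<in> borel_measurable borel"
    unfolding radial_weight_def by measurable
  let ?R = "density lborel (\<lambda>r. ennreal (?w r) * indicator {0..} r)"
  define M where "M = scale_measure (emeasure sphere_uniform B) ?R"
  define N where "N = distr (density lborel (\<lambda>z. indicator {z. sgn z \<in> B} z)) borel (norm :: 'a \<Rightarrow> real)"
  have N: "emeasure N A = emeasure lborel {z. norm z \<in> A \<and> sgn z \<in> B}" if [measurable]: "A \<in> sets borel" for A
  proof -
    have "emeasure N A = (\<integral>\<^sup>+z. indicator {z. sgn z \<in> B} z * indicator (norm -` A) z \<partial>lborel)"
      unfolding N_def using measurable_sets[OF borel_measurable_norm, of A]
      by (subst emeasure_distr, simp, simp) (subst emeasure_density, auto)
    also have "\<dots> = (\<integral>\<^sup>+z. indicator {z. norm z \<in> A \<and> sgn z \<in> B} z \<partial>lborel)"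
      by (intro nn_integral_cong) (auto split: split_indicator)
    also have "\<dots> = emeasure lborel {z. norm z \<in> A \<and> sgn z \<in> B}"
      by (rule nn_integral_indicator) simp
    finally show ?thesis .
  qed
  have M: "emeasure M A = emeasure ?R A * emeasure sphere_uniform B" for A
    by (simp add: M_def emeasure_scale_measure mult.commute)
  have lt: "emeasure M {..<x} = emeasure N {..<x}" for x
  proof (cases "0 < x")
    case True
    have "emeasure M {..<x} = ennreal (x ^ DIM('a)) * (emeasure sphere_uniform B * ennreal (unit_ball_vol DIM('a)))"
      unfolding M emeasure_radial using True by (simp add: ennreal_mult mult_ac)
    also have "\<dots> = emeasure N {..<x}"
      by (simp add: emeasure_sphere_uniform[OF B] emeasure_lborel_cone_scale[OF _ True, symmetric] N)
    finally show ?thesis .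
  next
    case False
    have "\<not> norm z < x" for z :: 'a
      using False norm_ge_zero[of z] by linarith
    then have "emeasure N {..<x} = 0" by (simp add: N)
    moreover have "max 0 x = 0" using False by simp
    then have "emeasure M {..<x} = 0"
      unfolding M emeasure_radial by (simp add: zero_power)
    ultimately show ?thesis by simp
  qed
  interpret prob_space "sphere_uniform :: 'a measure" by (rule prob_space_sphere_uniform)
  have "M = N"
  proof (rule measure_eqI_generator_eq[where E = "range lessThan" and \<Omega> = UNIV and A = "\<lambda>i::nat. {..<real i}"])
    show "Int_stable (range lessThan :: real set set)"
    proof (rule Int_stableI)
      fix a b :: "real set" assume "a \<in> range lessThan" "b \<in> range lessThan"
      then obtain x y where xy: "a = {..<x}" "b = {..<y}" by blast
      have "a \<inter> b = {..<min x y}" unfolding xy by auto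
      then show "a \<inter> b \<in> range lessThan" by blast
    qed
    show "sets M = sigma_sets UNIV (range lessThan)" "sets N = sigma_sets UNIV (range lessThan)"
      unfolding M_def N_def by (simp_all add: borel_Iio)
    show "(\<Union>i::nat. {..<real i}) = UNIV" by (auto simp: reals_Archimedean2)
    show "emeasure M {..<real i} \<noteq> \<infinity>" for i
      unfolding M emeasure_radial using emeasure_finite[of B] by (simp add: ennreal_mult_eq_top_iff)
  qed (use lt in auto)
  then show ?thesis using M[of A] N[OF A] by simp
qed

text \<open>The map to (norm, sgn) carries Lebesgue measure to a product measure, which need only be
  checked on rectangles. The origin is removed first because \<open>sgn 0\<close> is not on the
  sphere.\<close>

theorem nn_integral_polar:
  fixes g :: "'a::euclidean_space \<Rightarrow> ennreal"
  assumes g[measurable]: "g \<in> borel_measurable borel"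
  shows "(\<integral>\<^sup>+z. g z \<partial>lborel) = (\<integral>\<^sup>+v. \<integral>\<^sup>+r. ennreal (radial_weight TYPE('a) r) * indicator {0..} r * g (r *\<^sub>R v) \<partial>lborel \<partial>sphere_uniform)"
proof -
  let ?w = "radial_weight TYPE('a)"
  have w[measurable]: "?w \<in> borel_measurable borel"
    unfolding radial_weight_def by measurable
  let ?R = "density lborel (\<lambda>r. ennreal (?w r) * indicator {0..} r)"
  let ?S = "sphere_uniform :: 'a measure"
  let ?L = "restrict_space lborel (- {0 :: 'a})"
  let ?p = "\<lambda>z::'a. (norm z, sgn z)"
  interpret S: prob_space ?S by (rule prob_space_sphere_uniform)
  have id_S: "(\<lambda>v. v) \<in> ?S \<rightarrow>\<^sub>M borel"
    by (subst measurable_cong_sets[OF sets_sphere_uniform refl]) (rule measurable_restrict_space1, simp)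
  have "sgn \<in> ?L \<rightarrow>\<^sub>M restrict_space borel (sphere 0 1)"
    by (intro measurable_restrict_space2 measurable_restrict_space1) (auto simp: space_restrict_space norm_sgn)
  then have sgn_m: "sgn \<in> ?L \<rightarrow>\<^sub>M ?S"
    by (subst measurable_cong_sets[OF refl sets_sphere_uniform])
  have norm_m: "norm \<in> ?L \<rightarrow>\<^sub>M borel"
    by (intro measurable_restrict_space1) simp
  have p: "?p \<in> ?L \<rightarrow>\<^sub>M ?R \<Otimes>\<^sub>M ?S"
    using norm_m sgn_m by (intro measurable_Pair) simp_all
  have sf: "sigma_finite_measure ?R"
    by (subst sigma_finite_measure.sigma_finite_iff_density_finite[OF sigma_finite_lborel]) (auto split: split_indicator)
  have eq: "?R \<Otimes>\<^sub>M ?S = distr ?L (?R \<Otimes>\<^sub>M ?S) ?p"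
  proof (rule pair_measure_eqI)
    show "sigma_finite_measure ?S" by unfold_locales
    fix A B assume A: "A \<in> sets ?R" and B: "B \<in> sets ?S"
    have AB: "A \<times> B \<in> sets (?R \<Otimes>\<^sub>M ?S)" using A B by simp
    have "?p -` (A \<times> B) \<inter> space ?L = {z. norm z \<in> A \<and> sgn z \<in> B}"
      using sphere_uniform_measurableD(2)[OF B] by (auto simp: space_restrict_space sgn_zero_iff)
    then have "emeasure (distr ?L (?R \<Otimes>\<^sub>M ?S) ?p) (A \<times> B) = emeasure ?L {z. norm z \<in> A \<and> sgn z \<in> B}"
      using p AB by (simp add: emeasure_distr)
    also have "\<dots> = emeasure lborel {z. norm z \<in> A \<and> sgn z \<in> B}"
      using sphere_uniform_measurableD(2)[OF B] by (intro emeasure_restrict_space) auto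
    finally show "emeasure ?R A * emeasure ?S B = emeasure (distr ?L (?R \<Otimes>\<^sub>M ?S) ?p) (A \<times> B)"
      using emeasure_polar_rectangle[of A B] A B by simp
  qed (use sf in auto)
  interpret pair_sigma_finite ?R ?S
    using sf by (intro pair_sigma_finite.intro S.sigma_finite_measure_axioms)
  have G: "(\<lambda>(r, v). g (r *\<^sub>R v)) \<in> borel_measurable (?R \<Otimes>\<^sub>M ?S)"
    using id_S by measurable
  have "(\<integral>\<^sup>+z. g z \<partial>lborel) = (\<integral>\<^sup>+z. g z * indicator (- {0}) z \<partial>lborel)"
    by (rule nn_integral_cong_AE) (use AE_lborel_singleton[of 0] in eventually_elim, auto)
  also have "\<dots> = (\<integral>\<^sup>+z. g z \<partial>?L)"
    by (subst nn_integral_restrict_space) auto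
  also have "\<dots> = (\<integral>\<^sup>+z. (\<lambda>(r, v). g (r *\<^sub>R v)) (?p z) \<partial>?L)"
    by (intro nn_integral_cong) (auto simp: sgn_div_norm space_restrict_space)
  also have "\<dots> = (\<integral>\<^sup>+y. (\<lambda>(r, v). g (r *\<^sub>R v)) y \<partial>distr ?L (?R \<Otimes>\<^sub>M ?S) ?p)"
    by (subst nn_integral_distr[OF p]) (use G in simp_all)
  also have "\<dots> = (\<integral>\<^sup>+y. (\<lambda>(r, v). g (r *\<^sub>R v)) y \<partial>(?R \<Otimes>\<^sub>M ?S))"
    by (simp only: eq[symmetric])
  also have "\<dots> = (\<integral>\<^sup>+v. \<integral>\<^sup>+r. g (r *\<^sub>R v) \<partial>?R \<partial>?S)"
    by (subst nn_integral_snd[symmetric, OF G]) simp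
  also have "\<dots> = (\<integral>\<^sup>+v. \<integral>\<^sup>+r. ennreal (?w r) * indicator {0..} r * g (r *\<^sub>R v) \<partial>lborel \<partial>?S)"
    by (intro nn_integral_cong nn_integral_density) auto
  finally show ?thesis .
qed

subsection \<open>Implicit functions and differentiation under the integral\<close>

text \<open>Continuity of \<open>\<rho>\<close> is given, so the first-order expansion of
  \<open>H\<close> at one point suffices: it shows first that the increment of \<open>\<rho>\<close>
  is O(norm dx), and with this its own error becomes o(norm dx).\<close>

lemma implicit_GDERIV:
  fixes H :: "'a::real_inner \<times> real \<Rightarrow> real"
  assumes H: "GDERIV H (x0, \<rho> x0) :> (a, c)" and c: "0 < c"
    and cont: "isCont \<rho> x0"
    and zero: "\<forall>\<^sub>F x in nhds x0. H (x, \<rho> x) = H (x0, \<rho> x0)"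
  shows "GDERIV \<rho> x0 :> - (1 / c) *\<^sub>R a"
proof (rule GDERIV_I)
  fix e :: real assume e: "0 < e"
  define K where "K = (norm a + c) / (c / 2)"
  have K: "0 \<le> K" using c by (simp add: K_def)
  \<comment> \<open>The bound \<open>c / 2\<close> lets the \<open>dr\<close> part of the error be
    absorbed on the left, which produces the Lipschitz constant \<open>K\<close>; the other bound
    makes the remaining error, divided by \<open>c\<close>, at most
    \<open>e * norm dx\<close>.\<close>
  define \<eta> where "\<eta> = min (c / 2) (e * c / (1 + K))"
  have \<eta>: "0 < \<eta>" "\<eta> \<le> c / 2"
    unfolding \<eta>_def using c e K by (auto simp only: min.cobounded1) (simp add: min_def)
  have "\<eta> * (1 + K) \<le> e * c / (1 + K) * (1 + K)"
    using K by (intro mult_right_mono) (auto simp: \<eta>_def)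
  then have \<eta>K: "\<eta> * (1 + K) \<le> e * c" using K by simp
  have "\<exists>d>0. \<forall>y. norm (y - (x0, \<rho> x0)) < d \<longrightarrow>
      norm (H y - H (x0, \<rho> x0) - (y - (x0, \<rho> x0)) \<bullet> (a, c)) \<le> \<eta> * norm (y - (x0, \<rho> x0))"
    using H \<eta>(1) unfolding gderiv_def has_derivative_within_alt by simp
  then obtain d where d: "0 < d" "\<And>y. norm (y - (x0, \<rho> x0)) < d \<Longrightarrow>
      norm (H y - H (x0, \<rho> x0) - (y - (x0, \<rho> x0)) \<bullet> (a, c)) \<le> \<eta> * norm (y - (x0, \<rho> x0))"
    by blast
  have "\<forall>\<^sub>F x in nhds x0. dist (\<rho> x) (\<rho> x0) < d / 2"
    using cont d(1) unfolding isCont_def tendsto_at_iff_tendsto_nhds by (intro tendstoD) auto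
  moreover have "\<forall>\<^sub>F x in nhds x0. dist x x0 < d / 2"
    unfolding eventually_nhds_metric using d(1) by (intro exI[of _ "d / 2"]) auto
  ultimately have "\<forall>\<^sub>F x in nhds x0. dist (\<rho> x) (\<rho> x0) < d / 2 \<and> dist x x0 < d / 2 \<and> H (x, \<rho> x) = H (x0, \<rho> x0)"
    using zero by eventually_elim auto
  then obtain d' where d': "0 < d'" "\<And>x. dist x x0 < d' \<Longrightarrow>
      dist (\<rho> x) (\<rho> x0) < d / 2 \<and> dist x x0 < d / 2 \<and> H (x, \<rho> x) = H (x0, \<rho> x0)"
    unfolding eventually_nhds_metric by blast
  show "\<exists>d>0. \<forall>y. norm (y - x0) < d \<longrightarrow> \<bar>\<rho> y - \<rho> x0 - (- (1 / c) *\<^sub>R a) \<bullet> (y - x0)\<bar> \<le> e * norm (y - x0)"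
  proof (intro exI conjI allI impI)
    show "0 < d'" by fact
    fix x assume "norm (x - x0) < d'"
    note x = d'(2)[of x, unfolded dist_norm, OF this]
    define dx where "dx = x - x0"
    define dr where "dr = \<rho> x - \<rho> x0"
    have le: "norm (dx, dr) \<le> norm dx + \<bar>dr\<bar>"
      using norm_Pair_le[of dx dr] by simp
    have y: "(x, \<rho> x) - (x0, \<rho> x0) = (dx, dr)" by (simp add: dx_def dr_def)
    have "norm ((x, \<rho> x) - (x0, \<rho> x0)) < d"
      unfolding y using le x by (simp add: dx_def dr_def)
    from d(2)[OF this] have "\<bar>a \<bullet> dx + c * dr\<bar> \<le> \<eta> * norm (dx, dr)"
      unfolding y using x by (simp add: inner_commute algebra_simps)
    also have "\<dots> \<le> \<eta> * (norm dx + \<bar>dr\<bar>)" using le \<eta> by (intro mult_left_mono) auto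
    finally have b: "\<bar>a \<bullet> dx + c * dr\<bar> \<le> \<eta> * (norm dx + \<bar>dr\<bar>)" .
    have "c * \<bar>dr\<bar> = \<bar>c * dr\<bar>" using c by (simp add: abs_mult)
    also have "\<dots> \<le> \<bar>a \<bullet> dx\<bar> + \<bar>a \<bullet> dx + c * dr\<bar>" by linarith
    also have "\<dots> \<le> norm a * norm dx + \<eta> * (norm dx + \<bar>dr\<bar>)"
      using b Cauchy_Schwarz_ineq2[of a dx] by linarith
    also have "\<dots> \<le> norm a * norm dx + (c / 2) * (norm dx + \<bar>dr\<bar>)"
      using \<eta> by (intro add_left_mono mult_right_mono) auto
    finally have "(c / 2) * \<bar>dr\<bar> \<le> (norm a + c / 2) * norm dx"
      by (simp add: distrib_left distrib_right)
    also have "\<dots> \<le> (norm a + c) * norm dx" using c by (intro mult_right_mono) auto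
    finally have "\<bar>dr\<bar> \<le> K * norm dx" using c by (simp add: K_def field_simps)
    then have "\<eta> * (norm dx + \<bar>dr\<bar>) \<le> \<eta> * ((1 + K) * norm dx)"
      using \<eta> by (intro mult_left_mono) (auto simp: algebra_simps)
    also have "\<dots> = (\<eta> * (1 + K)) * norm dx" by simp
    also have "\<dots> \<le> (e * c) * norm dx" using \<eta>K by (intro mult_right_mono) auto
    finally have "\<bar>a \<bullet> dx + c * dr\<bar> \<le> c * (e * norm dx)" using b by (simp add: mult_ac)
    moreover have "a \<bullet> dx + c * dr = c * (dr - (- (1 / c) *\<^sub>R a) \<bullet> dx)"
      using c by (simp add: algebra_simps)
    ultimately have "c * \<bar>dr - (- (1 / c) *\<^sub>R a) \<bullet> dx\<bar> \<le> c * (e * norm dx)"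
      using c by (simp only: abs_mult abs_of_pos)
    then show "\<bar>\<rho> x - \<rho> x0 - (- (1 / c) *\<^sub>R a) \<bullet> (x - x0)\<bar> \<le> e * norm (x - x0)"
      using c unfolding dx_def dr_def by simp
  qed
qed

text \<open>On a compact parameter space joint continuity makes \<open>G\<close> continuous in
  \<open>x\<close> uniformly in \<open>v\<close>. The mean value inequality then bounds the
  linearisation error uniformly in \<open>v\<close>, which takes the place of a dominating
  function.\<close>

lemma GDERIV_integral:
  fixes e :: "'a::euclidean_space \<Rightarrow> 'b::euclidean_space \<Rightarrow> real"
  assumes S: "finite_measure S" "sets S = sets (restrict_space borel T)" and T: "compact T"
    and U: "open U"
    and int: "\<And>x. x \<in> U \<Longrightarrow> integrable S (e x)"
    and deriv: "\<And>x v. x \<in> U \<Longrightarrow> v \<in> T \<Longrightarrow> GDERIV (\<lambda>x. e x v) x :> G x v"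
    and cont: "continuous_on (U \<times> T) (\<lambda>p. G (fst p) (snd p))"
  shows "\<And>x. x \<in> U \<Longrightarrow> integrable S (G x)"
    and "\<And>x. x \<in> U \<Longrightarrow> GDERIV (\<lambda>x. \<integral>v. e x v \<partial>S) x :> (\<integral>v. G x v \<partial>S)"
    and "continuous_on U (\<lambda>x. \<integral>v. G x v \<partial>S)"
proof -
  interpret finite_measure S by fact
  have space: "space S = T"
    using sets_eq_imp_space_eq[OF S(2)] by (simp add: space_restrict_space)
  show intG: "integrable S (G x)" if "x \<in> U" for x
  proof -
    have c: "continuous_on T (G x)"
    proof -
      have "continuous_on T (Pair x)" by (intro continuous_intros)
      moreover have "Pair x ` T \<subseteq> U \<times> T" using that by auto
      ultimately show ?thesis using continuous_on_compose2[OF cont] by fastforce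
    qed
    obtain B where B: "\<And>v. v \<in> T \<Longrightarrow> norm (G x v) \<le> B"
      using compact_imp_bounded[OF compact_continuous_image[OF c T]] by (auto simp: bounded_iff)
    have "G x \<in> borel_measurable S"
      unfolding measurable_cong_sets[OF S(2) refl] by (rule borel_measurable_continuous_on_restrict[OF c])
    then show ?thesis
      by (intro integrable_const_bound[of _ B]) (auto simp: space B)
  qed
  have unif: "\<exists>d>0. ball x0 d \<subseteq> U \<and> (\<forall>x\<in>ball x0 d. \<forall>v\<in>T. norm (G x v - G x0 v) \<le> \<epsilon>)"
    if x0: "x0 \<in> U" and \<epsilon>: "0 < \<epsilon>" for x0 \<epsilon>
  proof -
    obtain X where X: "x0 \<in> X" "open X"
      "\<forall>x\<in>X \<inter> U. \<forall>v\<in>T. dist (G (fst (x, v)) (snd (x, v))) (G (fst (x0, v)) (snd (x0, v))) \<le> \<epsilon>"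
      using continuous_on_prod_compactE[OF cont T x0 \<epsilon>] by blast
    have "open (X \<inter> U)" "x0 \<in> X \<inter> U" using X U x0 by auto
    then obtain d where "0 < d" "ball x0 d \<subseteq> X \<inter> U" unfolding open_contains_ball by blast
    then show ?thesis using X(3) by (intro exI[of _ d]) (auto simp: dist_norm subset_iff)
  qed
  let ?m = "measure S (space S)"
  \<comment> \<open>The 1 guards against total mass zero and makes the last estimate of the
    continuity proof strict.\<close>
  have pos: "0 < ?m + 1" by (simp add: add_nonneg_pos)
  show "GDERIV (\<lambda>x. \<integral>v. e x v \<partial>S) x0 :> (\<integral>v. G x0 v \<partial>S)" if x0: "x0 \<in> U" for x0
  proof (rule GDERIV_I)
    fix \<epsilon> :: real assume "0 < \<epsilon>"
    then have "0 < \<epsilon> / (?m + 1)" using pos by simp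
    from unif[OF x0 this] obtain d where d: "0 < d" "ball x0 d \<subseteq> U"
      "\<And>x v. x \<in> ball x0 d \<Longrightarrow> v \<in> T \<Longrightarrow> norm (G x v - G x0 v) \<le> \<epsilon> / (?m + 1)" by blast
    show "\<exists>d>0. \<forall>y. norm (y - x0) < d \<longrightarrow>
        \<bar>(\<integral>v. e y v \<partial>S) - (\<integral>v. e x0 v \<partial>S) - (\<integral>v. G x0 v \<partial>S) \<bullet> (y - x0)\<bar> \<le> \<epsilon> * norm (y - x0)"
    proof (intro exI conjI allI impI)
      fix y assume "norm (y - x0) < d"
      then have y: "y \<in> ball x0 d" by (simp add: dist_norm norm_minus_commute)
      have yU: "y \<in> U" using y d by blast
      let ?k = "norm (y - x0) * (\<epsilon> / (?m + 1))"
      have bd: "norm (e y v - e x0 v - G x0 v \<bullet> (y - x0)) \<le> ?k" if v: "v \<in> T" for v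
      proof -
        have "norm (e y v - e x0 v - (y - x0) \<bullet> G x0 v) \<le> norm (y - x0) * (\<epsilon> / (?m + 1))"
        proof (rule differentiable_bound_linearization[where S = "ball x0 d" and f = "\<lambda>x. e x v" and f' = "\<lambda>x h. h \<bullet> G x v"])
          show "x0 + t *\<^sub>R (y - x0) \<in> ball x0 d" if "t \<in> {0..1}" for t
          proof -
            have "norm (t *\<^sub>R (y - x0)) \<le> 1 * norm (y - x0)"
              using that unfolding norm_scaleR by (intro mult_right_mono) auto
            then show ?thesis using y by (simp add: dist_norm norm_minus_commute)
          qed
          show "((\<lambda>x. e x v) has_derivative (\<lambda>h. h \<bullet> G x v)) (at x within ball x0 d)" if "x \<in> ball x0 d" for x
          proof -
            have "x \<in> U" using that d by blast
            then show ?thesis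
              using deriv[OF _ v] unfolding gderiv_def by (blast intro: has_derivative_at_withinI)
          qed
          show "onorm ((\<lambda>h. h \<bullet> G x v) - (\<lambda>h. h \<bullet> G x0 v)) \<le> \<epsilon> / (?m + 1)" if "x \<in> ball x0 d" for x
          proof (rule onorm_le)
            fix h
            have "\<bar>h \<bullet> (G x v - G x0 v)\<bar> \<le> norm h * norm (G x v - G x0 v)"
              by (rule Cauchy_Schwarz_ineq2)
            also have "\<dots> \<le> norm h * (\<epsilon> / (?m + 1))"
              using d(3)[OF that v] by (intro mult_left_mono) auto
            finally show "norm (((\<lambda>h. h \<bullet> G x v) - (\<lambda>h. h \<bullet> G x0 v)) h) \<le> \<epsilon> / (?m + 1) * norm h"
              by (simp add: inner_diff_right mult.commute)
          qed
        qed (use d in auto)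
        then show ?thesis by (simp only: inner_commute)
      qed
      have i: "integrable S (\<lambda>v. e y v - e x0 v - G x0 v \<bullet> (y - x0))"
        using int yU x0 intG[OF x0] by (intro Bochner_Integration.integrable_diff integrable_inner_left) auto
      have "(\<integral>v. e y v \<partial>S) - (\<integral>v. e x0 v \<partial>S) - (\<integral>v. G x0 v \<partial>S) \<bullet> (y - x0)
          = (\<integral>v. e y v - e x0 v - G x0 v \<bullet> (y - x0) \<partial>S)"
        using int[OF yU] int[OF x0] intG[OF x0] by simp
      also have "norm \<dots> \<le> (\<integral>v. ?k \<partial>S)"
        by (rule Bochner_Integration.integral_norm_bound_integral[OF i]) (use bd space in auto)
      also have "\<dots> = ?k * ?m" by simp
      also have "\<dots> = \<epsilon> * norm (y - x0) * (?m / (?m + 1))" by simp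
      also have "\<dots> \<le> \<epsilon> * norm (y - x0) * 1"
        using \<open>0 < \<epsilon>\<close> pos by (intro mult_left_mono) auto
      finally show "\<bar>(\<integral>v. e y v \<partial>S) - (\<integral>v. e x0 v \<partial>S) - (\<integral>v. G x0 v \<partial>S) \<bullet> (y - x0)\<bar> \<le> \<epsilon> * norm (y - x0)"
        by simp
    qed fact
  qed
  show "continuous_on U (\<lambda>x. \<integral>v. G x v \<partial>S)"
    unfolding continuous_on_iff
  proof (intro ballI allI impI)
    fix x0 and \<epsilon> :: real assume x0: "x0 \<in> U" and \<epsilon>: "0 < \<epsilon>"
    then have "0 < \<epsilon> / (?m + 1)" using pos by simp
    from unif[OF x0 this] obtain d where d: "0 < d"
      "\<And>x v. x \<in> ball x0 d \<Longrightarrow> v \<in> T \<Longrightarrow> norm (G x v - G x0 v) \<le> \<epsilon> / (?m + 1)" by blast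
    show "\<exists>d>0. \<forall>x\<in>U. dist x x0 < d \<longrightarrow> dist (\<integral>v. G x v \<partial>S) (\<integral>v. G x0 v \<partial>S) < \<epsilon>"
    proof (intro exI conjI ballI impI)
      fix x assume x: "x \<in> U" "dist x x0 < d"
      have "dist (\<integral>v. G x v \<partial>S) (\<integral>v. G x0 v \<partial>S) = norm (\<integral>v. G x v - G x0 v \<partial>S)"
        using intG x x0 by (simp add: dist_norm)
      also have "\<dots> \<le> (\<integral>v. \<epsilon> / (?m + 1) \<partial>S)"
        using intG x x0 d(2)[of x] by (intro Bochner_Integration.integral_norm_bound_integral) (auto simp: space dist_commute)
      also have "\<dots> = \<epsilon> * (?m / (?m + 1))" by simp
      also have "\<dots> < \<epsilon> * 1" using \<epsilon> pos by (intro mult_strict_left_mono) auto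
      finally show "dist (\<integral>v. G x v \<partial>S) (\<integral>v. G x0 v \<partial>S) < \<epsilon>" by simp
    qed fact
  qed
qed

subsection \<open>Rays leaving a convex sublevel set\<close>

lemma isCont_tendsto_nhds: "isCont f x \<Longrightarrow> (f \<longlongrightarrow> f x) (nhds x)"
  by (simp add: isCont_def tendsto_at_iff_tendsto_nhds)

text \<open>What the ray analysis uses of the envelope: the subgradient inequality controls the
  crossing of the level, and the Lipschitz gradient grows at most linearly along a ray.\<close>

locale radial_level =
  fixes E :: "'h::euclidean_space \<times> (real^'m) \<Rightarrow> real"
    and g :: "'h \<times> (real^'m) \<Rightarrow> 'h \<times> (real^'m)"
    and \<kappa> :: real
    and h :: "'h \<Rightarrow> real" and dh :: "'h \<Rightarrow> 'h"
    and L :: "real^'m^'m" and f :: "real^'m \<Rightarrow> real"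
  assumes E_GDERIV: "GDERIV E u :> g u"
    and E_subgradient: "E u + g u \<bullet> (w - u) \<le> E w"
    and g_lipschitz: "norm (g w - g u) \<le> \<kappa> * norm (w - u)"
    and h_GDERIV: "GDERIV h x :> dh x"
    and dh_cont: "continuous_on UNIV dh"
    and L_inv: "invertible L"
    and f_nonneg: "0 \<le> f z"
    and f_cont: "continuous_on UNIV f"
    and f_growth: "((\<lambda>z. norm z ^ (CARD('m) + 1) * f z) \<longlongrightarrow> 0) at_infinity"
begin

abbreviation A :: "real^'m \<Rightarrow> real^'m" where "A v \<equiv> L *v v"

abbreviation \<theta> :: "real \<Rightarrow> real^'m \<Rightarrow> real" where "\<theta> \<equiv> radial_density L f"

abbreviation Fin :: "'h \<Rightarrow> (real^'m) set" where "Fin \<equiv> finite_dirs L E h"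

abbreviation G :: "'h \<Rightarrow> real^'m \<Rightarrow> 'h" where "G \<equiv> gradient_integrand L f E h"

text \<open>This whole set, which is open, serves as the neighbourhood \<open>U\<close>.\<close>

definition slater_set :: "'h set" where "slater_set = {x. E (x, 0) < h x}"

text \<open>\<open>real_of_ereal\<close> sends infinity to 0, so \<open>\<rho>\<close> is the exit
  radius only where \<open>v \<in> Fin x\<close>.\<close>

definition \<rho> :: "'h \<Rightarrow> real^'m \<Rightarrow> real" where "\<rho> x v = real_of_ereal (radius L E h x v)"

definition radii :: "'h \<Rightarrow> real^'m \<Rightarrow> real set" where "radii x v = {r. 0 \<le> r \<and> E (x, r *\<^sub>R A v) \<le> h x}"

text \<open>The share of direction \<open>v\<close> in the probability: \<open>\<theta>\<close>
  contains the sphere area and the Jacobian of \<open>L\<close>, so the mean over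
  \<open>sphere_uniform\<close> is \<open>prob_function\<close>.\<close>

definition ray_prob :: "'h \<Rightarrow> real^'m \<Rightarrow> real" where "ray_prob x v = (LINT r:radii x v|lborel. \<theta> r v)"

lemma E_cont: "continuous_on UNIV E"
  by (intro continuous_at_imp_continuous_on ballI has_derivative_continuous[OF E_GDERIV[unfolded gderiv_def]])

lemma h_cont: "continuous_on UNIV h"
  by (intro continuous_at_imp_continuous_on ballI has_derivative_continuous[OF h_GDERIV[unfolded gderiv_def]])

lemma kappa_nonneg: "0 \<le> \<kappa>"
proof -
  obtain b :: 'h where "b \<in> Basis" using nonempty_Basis by blast
  then have "norm (b, 0 :: real^'m) = 1" by (simp add: norm_Pair)
  then have "norm (g (b, 0) - g 0) \<le> \<kappa>"
    using g_lipschitz[of "(b, 0)" 0] by simp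
  then show ?thesis by (rule order_trans[OF norm_ge_zero])
qed

lemma g_cont: "continuous_on UNIV g"
proof (rule lipschitz_on_continuous_on)
  show "\<kappa>-lipschitz_on UNIV g"
    using g_lipschitz kappa_nonneg by (intro lipschitz_onI) (auto simp: dist_norm)
qed

lemma A_cont: "continuous_on UNIV A"
  by (rule matrix_vector_mult_linear_continuous_on)

lemmas cont_rules = continuous_on_compose2[OF E_cont] continuous_on_compose2[OF h_cont]
  continuous_on_compose2[OF g_cont] continuous_on_compose2[OF A_cont] continuous_on_compose2[OF f_cont]
  continuous_on_compose2[OF dh_cont]

lemma cont_gap: "continuous_on UNIV (\<lambda>p. E (fst p, r *\<^sub>R A (snd p)) - h (fst p))"
  by (intro continuous_intros cont_rules) auto

lemma gap_nhds: "((\<lambda>p. E (fst p, r *\<^sub>R A (snd p)) - h (fst p)) \<longlongrightarrow> E (x, r *\<^sub>R A v) - h x) (nhds (x, v))"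
  using isCont_tendsto_nhds[of "(x, v)" "\<lambda>p. E (fst p, r *\<^sub>R A (snd p)) - h (fst p)"]
    cont_gap[of r] by (simp add: continuous_on_eq_continuous_at)

lemma open_slater_set: "open slater_set"
proof -
  have "continuous_on UNIV (\<lambda>x. E (x, 0))" by (intro continuous_intros cont_rules) auto
  then show ?thesis unfolding slater_set_def by (rule open_Collect_less[OF _ h_cont])
qed

lemma A_le: "norm v = 1 \<Longrightarrow> norm (A v) \<le> onorm A"
  using onorm[OF matrix_vector_mul_bounded_linear[of L], of v] by simp

lemma onorm_A_nonneg: "0 \<le> onorm A"
  by (rule onorm_pos_le[OF matrix_vector_mul_bounded_linear])

lemma E_ray: "E (x, r *\<^sub>R A v) + (s - r) * (snd (g (x, r *\<^sub>R A v)) \<bullet> A v) \<le> E (x, s *\<^sub>R A v)"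
proof -
  have "(x, s *\<^sub>R A v) - (x, r *\<^sub>R A v) = (0, (s - r) *\<^sub>R A v)" by (simp add: algebra_simps)
  then show ?thesis
    using E_subgradient[of "(x, r *\<^sub>R A v)" "(x, s *\<^sub>R A v)"] by (simp add: inner_prod_def)
qed

lemma crossing_slope:
  assumes "h x \<le> E (x, r *\<^sub>R A v)"
  shows "h x - E (x, 0) \<le> r * (snd (g (x, r *\<^sub>R A v)) \<bullet> A v)"
  using E_ray[of x r v 0] assms by simp

lemma crossing_slope_pos:
  assumes "x \<in> slater_set" "0 < r" "h x \<le> E (x, r *\<^sub>R A v)"
  shows "0 < snd (g (x, r *\<^sub>R A v)) \<bullet> A v"
proof -
  have "0 < h x - E (x, 0)" using assms(1) by (simp add: slater_set_def)
  then have "0 < r * (snd (g (x, r *\<^sub>R A v)) \<bullet> A v)"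
    using crossing_slope[OF assms(3)] by (rule less_le_trans)
  then show ?thesis using assms(2) by (rule zero_less_mult_pos)
qed

text \<open>The slope at \<open>r\<close> is positive because the ray starts strictly below the
  level, and \<open>E\<close> stays above its tangent. A ray that has reached the level therefore
  never returns.\<close>

lemma above_beyond:
  assumes "x \<in> slater_set" "0 < r" "r < s" "h x \<le> E (x, r *\<^sub>R A v)"
  shows "h x < E (x, s *\<^sub>R A v)"
proof -
  have "0 < (s - r) * (snd (g (x, r *\<^sub>R A v)) \<bullet> A v)"
    using crossing_slope_pos[OF assms(1,2,4)] assms(3) by simp
  then show ?thesis using E_ray[of x r v s] assms(4) by linarith
qed

lemma below_before:
  assumes "x \<in> slater_set" "0 \<le> r" "r < s" "E (x, s *\<^sub>R A v) \<le> h x"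
  shows "E (x, r *\<^sub>R A v) < h x"
proof (rule ccontr)
  assume "\<not> ?thesis"
  then have le: "h x \<le> E (x, r *\<^sub>R A v)" by simp
  then have "r \<noteq> 0" using assms(1) by (auto simp: slater_set_def)
  then show False
    using above_beyond[OF assms(1) _ assms(3) le] assms(2,4) by simp
qed

lemma level_iff:
  assumes "x \<in> slater_set" "0 < r" "E (x, r *\<^sub>R A v) = h x" "0 \<le> s"
  shows "E (x, s *\<^sub>R A v) \<le> h x \<longleftrightarrow> s \<le> r"
proof
  assume "E (x, s *\<^sub>R A v) \<le> h x"
  then show "s \<le> r" using above_beyond[OF assms(1,2), of s v] assms(3) by linarith
next
  assume "s \<le> r"
  then show "E (x, s *\<^sub>R A v) \<le> h x"
    using below_before[OF assms(1,4), of r v] assms(3) by (cases "s = r") auto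
qed

lemma radius_eq:
  assumes "x \<in> slater_set" "0 < r" "E (x, r *\<^sub>R A v) = h x"
  shows "radius L E h x v = ereal r"
proof -
  have "{ereal s | s. 0 < s \<and> E (x, s *\<^sub>R A v) \<le> h x} = ereal ` {0<..r}"
    using level_iff[OF assms] by (auto simp: image_iff)
  moreover have "Sup (ereal ` {0<..r}) = ereal r"
    by (rule cSup_eq_maximum) (use assms in auto)
  ultimately show ?thesis unfolding radius_def by simp
qed

lemma rho_props:
  assumes "x \<in> slater_set" "v \<in> Fin x"
  shows "0 < \<rho> x v" "E (x, \<rho> x v *\<^sub>R A v) = h x" "radii x v = {0..\<rho> x v}"
proof -
  obtain r where r: "0 < r" "E (x, r *\<^sub>R A v) = h x"
    using assms(2) unfolding finite_dirs_def by blast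
  have eq: "\<rho> x v = r"
    unfolding \<rho>_def radius_eq[OF assms(1) r] by simp
  then show "0 < \<rho> x v" "E (x, \<rho> x v *\<^sub>R A v) = h x" using r by auto
  show "radii x v = {0..\<rho> x v}"
    unfolding radii_def eq using level_iff[OF assms(1) r] by auto
qed

text \<open>The intermediate value theorem between the origin and \<open>r\<close>. One value above
  the level thus certifies a finite direction and bounds its radius, and such a certificate survives
  small perturbations.\<close>

lemma fin_crossing:
  assumes "x \<in> slater_set" "norm v = 1" "0 < r" "h x \<le> E (x, r *\<^sub>R A v)"
  shows "v \<in> Fin x" "\<rho> x v \<le> r"
proof -
  have "continuous_on {0..r} (\<lambda>r. E (x, r *\<^sub>R A v))"
    by (intro continuous_intros cont_rules) auto
  then obtain s where s: "0 \<le> s" "s \<le> r" "E (x, s *\<^sub>R A v) = h x"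
    using IVT'[of "\<lambda>r. E (x, r *\<^sub>R A v)" 0 "h x" r] assms by (auto simp: slater_set_def)
  then have "0 < s" using assms(1) by (cases "s = 0") (auto simp: slater_set_def)
  then show "v \<in> Fin x" "\<rho> x v \<le> r"
    using s assms(2) radius_eq[OF assms(1) _ s(3)] by (auto simp: finite_dirs_def \<rho>_def)
qed

lemma rho_gt:
  assumes "x \<in> slater_set" "v \<in> Fin x" "E (x, r *\<^sub>R A v) < h x"
  shows "r < \<rho> x v"
proof (rule ccontr)
  assume "\<not> r < \<rho> x v"
  then have "\<rho> x v < r \<or> \<rho> x v = r" by auto
  then show False
    using above_beyond[OF assms(1) rho_props(1)[OF assms(1,2)], of r v] rho_props(2)[OF assms(1,2)] assms(3)
    by auto
qed

lemma inf_dir: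
  assumes "x \<in> slater_set" "norm v = 1" "v \<notin> Fin x" "0 \<le> r"
  shows "E (x, r *\<^sub>R A v) < h x"
proof (cases "r = 0")
  case False
  then have "0 < r" using assms(4) by simp
  then show ?thesis
    using fin_crossing(1)[OF assms(1,2)] assms(3) by (intro not_le_imp_less) blast
qed (use assms in \<open>simp add: slater_set_def\<close>)

lemma inf_radii:
  assumes "x \<in> slater_set" "norm v = 1" "v \<notin> Fin x"
  shows "radii x v = {0..}"
  using inf_dir[OF assms] unfolding radii_def by (auto intro: less_imp_le)

text \<open>The gap has strict signs at the two radii \<open>\<rho> x0 v0 + \<epsilon>\<close> and
  \<open>\<rho> x0 v0 - \<epsilon>\<close>, and these persist nearby by continuity.
  \<open>fin_crossing\<close> and \<open>rho_gt\<close> turn them into finiteness and two-sided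
  bounds.\<close>

lemma rho_tendsto:
  assumes "x0 \<in> slater_set" "norm v0 = 1" "v0 \<in> Fin x0"
  shows "\<forall>\<^sub>F p in at (x0, v0) within slater_set \<times> sphere 0 1. snd p \<in> Fin (fst p)"
    and "((\<lambda>p. \<rho> (fst p) (snd p)) \<longlongrightarrow> \<rho> x0 v0) (at (x0, v0) within slater_set \<times> sphere 0 1)"
proof -
  let ?F = "at (x0, v0) within slater_set \<times> sphere 0 1"
  note r = rho_props[OF assms(1,3)]
  have near: "\<forall>\<^sub>F p in ?F. snd p \<in> Fin (fst p) \<and> \<rho> x0 v0 - \<epsilon> < \<rho> (fst p) (snd p) \<and> \<rho> (fst p) (snd p) \<le> \<rho> x0 v0 + \<epsilon>"
    if \<epsilon>: "0 < \<epsilon>" "\<epsilon> < \<rho> x0 v0" for \<epsilon>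
  proof -
    have "h x0 < E (x0, (\<rho> x0 v0 + \<epsilon>) *\<^sub>R A v0)"
      using above_beyond[OF assms(1) r(1), of "\<rho> x0 v0 + \<epsilon>" v0] r(2) \<epsilon> by simp
    then have up: "\<forall>\<^sub>F p in nhds (x0, v0). 0 < E (fst p, (\<rho> x0 v0 + \<epsilon>) *\<^sub>R A (snd p)) - h (fst p)"
      by (intro order_tendstoD(1)[OF gap_nhds]) simp
    have "E (x0, (\<rho> x0 v0 - \<epsilon>) *\<^sub>R A v0) < h x0"
      using below_before[OF assms(1), of "\<rho> x0 v0 - \<epsilon>" "\<rho> x0 v0" v0] r(2) \<epsilon> by simp
    then have lo: "\<forall>\<^sub>F p in nhds (x0, v0). E (fst p, (\<rho> x0 v0 - \<epsilon>) *\<^sub>R A (snd p)) - h (fst p) < 0"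
      by (intro order_tendstoD(2)[OF gap_nhds]) simp
    have "\<forall>\<^sub>F p in ?F. p \<in> slater_set \<times> sphere 0 1"
      by (simp add: eventually_at_filter)
    moreover have "\<forall>\<^sub>F p in ?F. 0 < E (fst p, (\<rho> x0 v0 + \<epsilon>) *\<^sub>R A (snd p)) - h (fst p)"
      "\<forall>\<^sub>F p in ?F. E (fst p, (\<rho> x0 v0 - \<epsilon>) *\<^sub>R A (snd p)) - h (fst p) < 0"
      using up lo unfolding eventually_at_filter by (auto elim: eventually_mono)
    ultimately show ?thesis
    proof eventually_elim
      case (elim p)
      obtain x v where p: "p = (x, v)" by (cases p)
      have x: "x \<in> slater_set" "norm v = 1" using elim(1) by (auto simp: p)
      have "v \<in> Fin x" "\<rho> x v \<le> \<rho> x0 v0 + \<epsilon>"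
        using fin_crossing[OF x, of "\<rho> x0 v0 + \<epsilon>"] elim(2) \<epsilon> by (auto simp: p)
      moreover have "\<rho> x0 v0 - \<epsilon> < \<rho> x v"
        using rho_gt[OF x(1) \<open>v \<in> Fin x\<close>, of "\<rho> x0 v0 - \<epsilon>"] elim(3) by (auto simp: p)
      ultimately show ?case by (simp add: p)
    qed
  qed
  show "\<forall>\<^sub>F p in ?F. snd p \<in> Fin (fst p)"
    using near[of "\<rho> x0 v0 / 2"] r(1) by (auto elim: eventually_mono)
  show "((\<lambda>p. \<rho> (fst p) (snd p)) \<longlongrightarrow> \<rho> x0 v0) ?F"
  proof (rule tendstoI)
    fix \<epsilon> :: real assume "0 < \<epsilon>"
    define \<delta> where "\<delta> = min (\<epsilon> / 2) (\<rho> x0 v0 / 2)"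
    have "0 < \<delta>" "\<delta> < \<rho> x0 v0" "\<delta> < \<epsilon>" using \<open>0 < \<epsilon>\<close> r(1) by (auto simp: \<delta>_def min_def)
    from near[OF this(1,2)] show "\<forall>\<^sub>F p in ?F. dist (\<rho> (fst p) (snd p)) (\<rho> x0 v0) < \<epsilon>"
      by eventually_elim (use \<open>\<delta> < \<epsilon>\<close> in \<open>auto simp: dist_real_def\<close>)
  qed
qed

subsection \<open>Continuity of the gradient integrand\<close>

definition radial_const :: real where
  "radial_const = 2 * pi powr (real CARD('m) / 2) * \<bar>det L\<bar> / Gamma (real CARD('m) / 2)"

lemma radial_const_nonneg: "0 \<le> radial_const"
  unfolding radial_const_def by (intro divide_nonneg_nonneg less_imp_le[OF Gamma_real_pos]) auto

lemma theta_eq: "\<theta> r v = radial_const * r ^ (CARD('m) - 1) * f (r *\<^sub>R A v)"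
  unfolding radial_density_def radial_const_def ..

lemma theta_nonneg: "0 \<le> r \<Longrightarrow> 0 \<le> \<theta> r v"
  unfolding theta_eq by (intro mult_nonneg_nonneg radial_const_nonneg f_nonneg) auto

lemma theta_cont: "continuous_on UNIV (\<lambda>p. \<theta> (fst p) (snd p))"
  unfolding theta_eq by (intro continuous_intros cont_rules) auto

text \<open>The factor \<open>r\<^sup>2\<close> completes the m - 1 of the radial density to the
  exponent m + 1. Invertibility of \<open>L\<close> bounds norm (A v) below on the sphere, which
  makes the estimate uniform in \<open>v\<close>.\<close>

lemma theta_growth:
  assumes "0 < \<epsilon>"
  obtains R where "1 \<le> R" "\<And>r v. R \<le> r \<Longrightarrow> norm v = 1 \<Longrightarrow> r\<^sup>2 * \<theta> r v \<le> \<epsilon>"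
proof -
  have "inj A" using L_inv by (simp add: inj_matrix_vector_mult)
  then obtain a where a: "0 < a" "\<And>v. a * norm v \<le> norm (A v)"
    using linear_inj_bounded_below_pos[OF matrix_vector_mul_linear] by blast
  define k where "k = CARD('m) + 1"
  \<comment> \<open>\<open>a ^ k\<close> is the loss in passing from the norm of
    \<open>r *\<^sub>R A v\<close> to \<open>r\<close>; adding 1 avoids division by zero, as only
    nonnegativity of \<open>radial_const\<close> is at hand.\<close>
  define \<eta> where "\<eta> = \<epsilon> * a ^ k / (radial_const + 1)"
  have "0 < \<eta>" using a assms radial_const_nonneg by (simp add: \<eta>_def)
  then have "\<forall>\<^sub>F z in at_infinity. dist (norm z ^ k * f z) 0 < \<eta>"
    using f_growth unfolding k_def by (intro tendstoD)
  then obtain b where b: "\<And>z. b \<le> norm z \<Longrightarrow> norm z ^ k * f z < \<eta>"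
    unfolding eventually_at_infinity by (fastforce simp: dist_real_def)
  show ?thesis
  proof
    show "1 \<le> max 1 (b / a)" by simp
    fix r and v :: "real^'m" assume r: "max 1 (b / a) \<le> r" and v: "norm v = 1"
    have r0: "0 \<le> r" using r by simp
    let ?z = "r *\<^sub>R A v"
    have z: "r * a \<le> norm ?z"
      using a(2)[of v] v r0 by (simp add: mult_left_mono)
    have "b / a \<le> r" using r by simp
    then have "b \<le> r * a" using a by (simp add: pos_divide_le_eq)
    then have "norm ?z ^ k * f ?z < \<eta>" using z by (intro b) linarith
    moreover have "(r * a) ^ k * f ?z \<le> norm ?z ^ k * f ?z"
      using z a r0 f_nonneg by (intro mult_right_mono power_mono) auto
    ultimately have "(r ^ k * f ?z) * a ^ k \<le> \<eta>" by (simp add: power_mult_distrib mult_ac)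
    then have "(r ^ k * f ?z) * a ^ k \<le> \<epsilon> / (radial_const + 1) * a ^ k" by (simp add: \<eta>_def)
    then have "r ^ k * f ?z \<le> \<epsilon> / (radial_const + 1)"
      by (rule mult_right_le_imp_le) (use a(1) in simp)
    then have "radial_const * (r ^ k * f ?z) \<le> radial_const * (\<epsilon> / (radial_const + 1))"
      using radial_const_nonneg by (rule mult_left_mono)
    also have "\<dots> \<le> \<epsilon>" using radial_const_nonneg assms by (simp add: field_simps)
    finally have "radial_const * (r ^ k * f ?z) \<le> \<epsilon>" .
    moreover have "r ^ k = r\<^sup>2 * r ^ (CARD('m) - 1)"
    proof -
      have "k = 2 + (CARD('m) - 1)" unfolding k_def using zero_less_card_finite[where 'a = 'm] by simp
      then show ?thesis by (simp only: power_add)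
    qed
    ultimately show "r\<^sup>2 * \<theta> r v \<le> \<epsilon>" by (simp add: theta_eq mult_ac)
  qed
qed

text \<open>Makes the coefficient in \<open>G_bound\<close> uniform for \<open>x\<close> near
  \<open>x0\<close>; half of the gap at \<open>x0\<close> leaves room for its variation.\<close>

lemma local_bounds:
  assumes "x0 \<in> slater_set"
  obtains \<delta> B where "0 < \<delta>" "0 < B"
    "\<forall>\<^sub>F x in nhds x0. x \<in> slater_set \<and> \<delta> \<le> h x - E (x, 0) \<and> norm (g (x, 0)) \<le> B \<and> norm (dh x) \<le> B"
proof -
  define \<delta> where "\<delta> = (h x0 - E (x0, 0)) / 2"
  define B where "B = norm (g (x0, 0)) + norm (dh x0) + 1"
  have \<delta>: "0 < \<delta>" using assms by (simp add: \<delta>_def slater_set_def)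
  have lim: "(F \<longlongrightarrow> F x0) (nhds x0)" if "continuous_on UNIV F" for F :: "'h \<Rightarrow> real"
    using that by (intro isCont_tendsto_nhds) (simp add: continuous_on_eq_continuous_at)
  have "continuous_on UNIV (\<lambda>x. h x - E (x, 0))" "continuous_on UNIV (\<lambda>x. norm (g (x, 0)))"
    "continuous_on UNIV (\<lambda>x. norm (dh x))"
    by (intro continuous_intros cont_rules; simp)+
  note l = this[THEN lim]
  have "\<forall>\<^sub>F x in nhds x0. \<delta> < h x - E (x, 0)"
    using \<delta> by (intro order_tendstoD(1)[OF l(1)]) (simp add: \<delta>_def)
  moreover have "\<forall>\<^sub>F x in nhds x0. norm (g (x, 0)) < B" "\<forall>\<^sub>F x in nhds x0. norm (dh x) < B"
    by (intro order_tendstoD(2)[OF l(2)] order_tendstoD(2)[OF l(3)]; simp add: B_def add_nonneg_pos)+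
  moreover have "\<forall>\<^sub>F x in nhds x0. x \<in> slater_set"
    using open_slater_set assms by (rule eventually_nhds_in_open)
  ultimately have "\<forall>\<^sub>F x in nhds x0. x \<in> slater_set \<and> \<delta> \<le> h x - E (x, 0) \<and> norm (g (x, 0)) \<le> B \<and> norm (dh x) \<le> B"
    by eventually_elim auto
  moreover have "0 < B" unfolding B_def by (simp add: add_nonneg_pos)
  ultimately show ?thesis using that \<delta> by blast
qed

lemma g_ray_bound:
  assumes "norm v = 1" "1 \<le> r"
  shows "norm (g (x, r *\<^sub>R A v)) \<le> (norm (g (x, 0)) + \<kappa> * onorm A) * r"
proof -
  have "norm (r *\<^sub>R A v) \<le> r * onorm A"
    using A_le[OF assms(1)] assms(2) by (simp add: mult_left_mono)
  then have "\<kappa> * norm (r *\<^sub>R A v) \<le> \<kappa> * (r * onorm A)"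
    using kappa_nonneg by (rule mult_left_mono)
  moreover have "norm (g (x, r *\<^sub>R A v) - g (x, 0)) \<le> \<kappa> * norm (r *\<^sub>R A v)"
    using g_lipschitz[of "(x, r *\<^sub>R A v)" "(x, 0)"] by (simp add: norm_Pair)
  moreover have "norm (g (x, r *\<^sub>R A v)) \<le> norm (g (x, 0)) + norm (g (x, r *\<^sub>R A v) - g (x, 0))"
    by (rule norm_triangle_sub)
  moreover have "norm (g (x, 0)) * 1 \<le> norm (g (x, 0)) * r"
    using assms(2) by (intro mult_left_mono) auto
  ultimately show ?thesis by (simp add: algebra_simps)
qed

lemma grad_z_E: "grad_z E u = snd (g u)"
  unfolding grad_z_def
proof (rule grad_eq)
  have "(E has_derivative (\<lambda>k. k \<bullet> g u)) (at (fst u, snd u))"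
    using E_GDERIV[of u] by (simp add: gderiv_def)
  then have "((\<lambda>z. E (fst u, z)) has_derivative (\<lambda>k. (0, k) \<bullet> g u)) (at (snd u))"
    by (rule has_derivative_compose[rotated]) (auto intro!: derivative_eq_intros)
  then show "GDERIV (\<lambda>z. E (fst u, z)) (snd u) :> snd (g u)"
    by (simp add: gderiv_def inner_prod_def)
qed

lemma grad_x_E: "grad_x E u = fst (g u)"
  unfolding grad_x_def
proof (rule grad_eq)
  have "(E has_derivative (\<lambda>k. k \<bullet> g u)) (at (fst u, snd u))"
    using E_GDERIV[of u] by (simp add: gderiv_def)
  then have "((\<lambda>x. E (x, snd u)) has_derivative (\<lambda>k. (k, 0) \<bullet> g u)) (at (fst u))"
    by (rule has_derivative_compose[rotated]) (auto intro!: derivative_eq_intros)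
  then show "GDERIV (\<lambda>x. E (x, snd u)) (fst u) :> fst (g u)"
    by (simp add: gderiv_def inner_prod_def)
qed

text \<open>The finite case of \<open>G\<close> with the radius as a free variable: its continuity
  is then a matter of composition, separate from that of \<open>\<rho>\<close>.\<close>

definition ray_grad :: "'h \<Rightarrow> real \<Rightarrow> real^'m \<Rightarrow> 'h" where
  "ray_grad x r v = - (\<theta> r v / (snd (g (x, r *\<^sub>R A v)) \<bullet> A v)) *\<^sub>R (fst (g (x, r *\<^sub>R A v)) - dh x)"

lemma G_fin: "v \<in> Fin x \<Longrightarrow> G x v = ray_grad x (\<rho> x v) v"
  unfolding gradient_integrand_def ray_grad_def Let_def grad_z_E grad_x_E grad_eq[OF h_GDERIV] \<rho>_def by simp

lemma G_inf: "v \<notin> Fin x \<Longrightarrow> G x v = 0"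
  unfolding gradient_integrand_def by simp

text \<open>One factor of the radius comes from the reciprocal slope, by
  \<open>crossing_slope\<close>, the other from the gradient, by \<open>g_ray_bound\<close>; radius
  at least 1 lets constant terms be absorbed.\<close>

lemma G_bound:
  assumes "x \<in> slater_set" "v \<in> Fin x" "1 \<le> \<rho> x v"
  shows "norm (G x v) \<le> (norm (g (x, 0)) + \<kappa> * onorm A + norm (dh x)) / (h x - E (x, 0)) * ((\<rho> x v)\<^sup>2 * \<theta> (\<rho> x v) v)"
proof -
  have v: "norm v = 1" using assms(2) by (simp add: finite_dirs_def)
  note r = rho_props[OF assms(1,2)]
  define t where "t = \<rho> x v"
  define s where "s = snd (g (x, t *\<^sub>R A v)) \<bullet> A v"
  define \<gamma> where "\<gamma> = h x - E (x, 0)"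
  define K where "K = norm (g (x, 0)) + \<kappa> * onorm A + norm (dh x)"
  have t: "1 \<le> t" using assms by (simp add: t_def)
  have \<gamma>: "0 < \<gamma>" "\<gamma> \<le> t * s"
    using crossing_slope[of x t v] r(2) assms(1) by (simp_all add: \<gamma>_def slater_set_def t_def s_def)
  have "0 < t * s" using \<gamma> by linarith
  then have s: "0 < s" using t by (simp add: zero_less_mult_iff)
  have \<theta>: "0 \<le> \<theta> t v" using t by (intro theta_nonneg) auto
  have "1 / s \<le> t / \<gamma>" using \<gamma> s by (simp add: field_simps)
  then have a: "\<theta> t v / s \<le> \<theta> t v * (t / \<gamma>)" using mult_left_mono[OF _ \<theta>] by fastforce
  have "norm (fst (g (x, t *\<^sub>R A v)) - dh x) \<le> norm (g (x, t *\<^sub>R A v)) + norm (dh x)"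
    using norm_triangle_ineq4[of "fst (g (x, t *\<^sub>R A v))" "dh x"] norm_fst_le[of "fst (g (x, t *\<^sub>R A v))" "snd (g (x, t *\<^sub>R A v))"]
    by simp
  also have "\<dots> \<le> (norm (g (x, 0)) + \<kappa> * onorm A) * t + norm (dh x) * t"
    using g_ray_bound[OF v t, of x] mult_left_mono[OF t norm_ge_zero[of "dh x"]] by simp
  also have "\<dots> = K * t" by (simp add: K_def algebra_simps)
  finally have b: "norm (fst (g (x, t *\<^sub>R A v)) - dh x) \<le> K * t" .
  have "norm (G x v) = \<theta> t v / s * norm (fst (g (x, t *\<^sub>R A v)) - dh x)"
    using \<theta> s unfolding G_fin[OF assms(2)] ray_grad_def t_def[symmetric] s_def[symmetric] by simp
  also have "\<dots> \<le> \<theta> t v * (t / \<gamma>) * (K * t)"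
    using a b \<theta> t \<gamma> s by (intro mult_mono) auto
  also have "\<dots> = K / \<gamma> * (t\<^sup>2 * \<theta> t v)" by (simp add: power2_eq_square)
  finally show ?thesis by (simp only: K_def \<gamma>_def t_def)
qed

text \<open>The gap at radius \<open>R\<close> is strictly negative on an infinite ray and so on
  nearby rays. These may again be infinite, hence the implication.\<close>

lemma rho_large:
  assumes "x0 \<in> slater_set" "norm v0 = 1" "v0 \<notin> Fin x0" "0 \<le> R"
  shows "\<forall>\<^sub>F p in nhds (x0, v0). snd p \<in> Fin (fst p) \<longrightarrow> R < \<rho> (fst p) (snd p)"
proof -
  have "\<forall>\<^sub>F p in nhds (x0, v0). E (fst p, R *\<^sub>R A (snd p)) - h (fst p) < 0"
    using inf_dir[OF assms] by (intro order_tendstoD(2)[OF gap_nhds]) simp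
  moreover have "\<forall>\<^sub>F p in nhds (x0, v0). p \<in> slater_set \<times> UNIV"
    using open_slater_set assms(1) by (intro eventually_nhds_in_open open_Times) auto
  ultimately show ?thesis
    by eventually_elim (auto intro: rho_gt)
qed

text \<open>At a finite direction \<open>G\<close> is a continuous expression in the continuous
  radius. At an infinite one its value is 0, and nearby it is either 0 by definition or controlled
  by \<open>G_bound\<close> with a radius that \<open>rho_large\<close> forces to be large.\<close>

lemma G_cont: "continuous_on (slater_set \<times> sphere 0 1) (\<lambda>p. G (fst p) (snd p))"
  unfolding continuous_on_def
proof
  fix p0 assume "p0 \<in> slater_set \<times> sphere (0::real^'m) 1"
  then obtain x0 v0 where p0: "p0 = (x0, v0)" and x0: "x0 \<in> slater_set" and v0: "norm v0 = 1"
    by (cases p0) auto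
  let ?F = "at p0 within slater_set \<times> sphere 0 1"
  show "((\<lambda>p. G (fst p) (snd p)) \<longlongrightarrow> G (fst p0) (snd p0)) ?F"
  proof (cases "v0 \<in> Fin x0")
    case True
    note r = rho_props[OF x0 True]
    note lim = rho_tendsto[OF x0 v0 True, folded p0]
    have nz: "snd (g (x0, \<rho> x0 v0 *\<^sub>R A v0)) \<bullet> A v0 \<noteq> 0"
      using crossing_slope_pos[OF x0 r(1), of v0] r(2) by simp
    have "((\<lambda>p. (fst p, \<rho> (fst p) (snd p), snd p)) \<longlongrightarrow> (x0, \<rho> x0 v0, v0)) ?F"
    proof (intro tendsto_Pair lim)
      show "(fst \<longlongrightarrow> x0) ?F" "(snd \<longlongrightarrow> v0) ?F"
        unfolding p0 using tendsto_fst[OF tendsto_ident_at] tendsto_snd[OF tendsto_ident_at] by fastforce+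
    qed
    moreover have "isCont (\<lambda>(x, r, v). ray_grad x r v) (x0, \<rho> x0 v0, v0)"
    proof -
      have 1: "isCont (\<lambda>p. \<theta> (fst (snd p)) (snd (snd p))) q" for q :: "'h \<times> real \<times> (real^'m)"
        using continuous_on_compose2[OF theta_cont, of UNIV "snd :: 'h \<times> real \<times> (real^'m) \<Rightarrow> _"]
        by (cases q) (simp add: continuous_on_eq_continuous_at continuous_on_snd)
      have "continuous_on UNIV (\<lambda>p :: 'h \<times> real \<times> (real^'m). g (fst p, fst (snd p) *\<^sub>R A (snd (snd p))))"
        "continuous_on UNIV (\<lambda>p :: 'h \<times> real \<times> (real^'m). A (snd (snd p)))"
        "continuous_on UNIV (\<lambda>p :: 'h \<times> real \<times> (real^'m). dh (fst p))"
        by (intro continuous_intros cont_rules; simp)+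
      then have 2: "isCont (\<lambda>p :: 'h \<times> real \<times> (real^'m). g (fst p, fst (snd p) *\<^sub>R A (snd (snd p)))) q"
        "isCont (\<lambda>p :: 'h \<times> real \<times> (real^'m). A (snd (snd p))) q"
        "isCont (\<lambda>p :: 'h \<times> real \<times> (real^'m). dh (fst p)) q" for q
        by (cases q; simp add: continuous_on_eq_continuous_at)+
      show ?thesis
        unfolding ray_grad_def case_prod_beta by (intro continuous_intros 1 2) (use nz in simp)
    qed
    ultimately have "((\<lambda>p. ray_grad (fst p) (\<rho> (fst p) (snd p)) (snd p)) \<longlongrightarrow> ray_grad x0 (\<rho> x0 v0) v0) ?F"
      using isCont_tendsto_compose[of "(x0, \<rho> x0 v0, v0)" "\<lambda>(x, r, v). ray_grad x r v"] by fastforce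
    moreover have "\<forall>\<^sub>F p in ?F. ray_grad (fst p) (\<rho> (fst p) (snd p)) (snd p) = G (fst p) (snd p)"
      using lim(1) by eventually_elim (rule G_fin[symmetric])
    ultimately have "((\<lambda>p. G (fst p) (snd p)) \<longlongrightarrow> ray_grad x0 (\<rho> x0 v0) v0) ?F"
      by (rule Lim_transform_eventually)
    then show ?thesis by (simp add: p0 G_fin[OF True])
  next
    case False
    obtain \<delta> B where \<delta>: "0 < \<delta>" "0 < B"
      "\<forall>\<^sub>F x in nhds x0. x \<in> slater_set \<and> \<delta> \<le> h x - E (x, 0) \<and> norm (g (x, 0)) \<le> B \<and> norm (dh x) \<le> B"
      using local_bounds[OF x0] by blast
    define K where "K = (B + \<kappa> * onorm A + B) / \<delta>"
    have K: "0 < K" using \<delta> kappa_nonneg onorm_A_nonneg by (simp add: K_def add_pos_nonneg)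
    have "\<forall>\<^sub>F p in ?F. dist (G (fst p) (snd p)) 0 < \<epsilon>" if \<epsilon>: "0 < \<epsilon>" for \<epsilon>
    proof -
      have "0 < \<epsilon> / (2 * K)" using \<epsilon> K by simp
      then obtain R where R: "1 \<le> R" "\<And>r v. R \<le> r \<Longrightarrow> norm v = 1 \<Longrightarrow> r\<^sup>2 * \<theta> r v \<le> \<epsilon> / (2 * K)"
        using theta_growth by blast
      have "\<forall>\<^sub>F p in nhds p0. snd p \<in> Fin (fst p) \<longrightarrow> R < \<rho> (fst p) (snd p)"
        unfolding p0 using rho_large[OF x0 v0 False] R by simp
      moreover have "(fst \<longlongrightarrow> x0) (nhds p0)"
        using isCont_tendsto_nhds[of p0 fst] by (simp add: p0)
      then have "\<forall>\<^sub>F p in nhds p0. fst p \<in> slater_set \<and> \<delta> \<le> h (fst p) - E (fst p, 0) \<and> norm (g (fst p, 0)) \<le> B \<and> norm (dh (fst p)) \<le> B"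
        using \<delta>(3) unfolding filterlim_iff by blast
      ultimately have "\<forall>\<^sub>F p in nhds p0. dist (G (fst p) (snd p)) 0 < \<epsilon>"
      proof eventually_elim
        case (elim p)
        obtain x v where p: "p = (x, v)" by (cases p)
        show ?case
        proof (cases "v \<in> Fin x")
          case True
          have b: "R < \<rho> x v" "x \<in> slater_set" "\<delta> \<le> h x - E (x, 0)" "norm (g (x, 0)) \<le> B" "norm (dh x) \<le> B"
            using elim True by (auto simp: p)
          have v: "norm v = 1" using True by (simp add: finite_dirs_def)
          have q: "(\<rho> x v)\<^sup>2 * \<theta> (\<rho> x v) v \<le> \<epsilon> / (2 * K)" "0 \<le> (\<rho> x v)\<^sup>2 * \<theta> (\<rho> x v) v"
            using R(2)[OF _ v, of "\<rho> x v"] b R theta_nonneg[of "\<rho> x v" v] by auto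
          have "norm (G x v) \<le> (norm (g (x, 0)) + \<kappa> * onorm A + norm (dh x)) / (h x - E (x, 0)) * ((\<rho> x v)\<^sup>2 * \<theta> (\<rho> x v) v)"
            using b R True by (intro G_bound) auto
          also have "\<dots> \<le> K * (\<epsilon> / (2 * K))"
          proof (intro mult_mono q)
            show "(norm (g (x, 0)) + \<kappa> * onorm A + norm (dh x)) / (h x - E (x, 0)) \<le> K"
              unfolding K_def using b \<delta> kappa_nonneg onorm_A_nonneg
              by (intro frac_le) auto
          qed (use K in auto)
          also have "\<dots> = \<epsilon> / 2" using K by simp
          finally show ?thesis using \<epsilon> by (simp add: p)
        qed (use \<epsilon> in \<open>simp add: p G_inf\<close>)
      qed
      then show ?thesis unfolding eventually_at_filter by (auto elim: eventually_mono)
    qed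
    then have "((\<lambda>p. G (fst p) (snd p)) \<longlongrightarrow> 0) ?F" by (rule tendstoI)
    then show ?thesis by (simp add: p0 G_inf[OF False])
  qed
qed

subsection \<open>The mass of a ray and its gradient\<close>

lemma theta_cont_ray: "continuous_on S (\<lambda>r. \<theta> r v)"
proof -
  have "continuous_on UNIV (\<lambda>r. \<theta> r v)"
    unfolding theta_eq by (intro continuous_intros cont_rules) auto
  then show ?thesis by (rule continuous_on_subset) simp
qed

lemma theta_measurable [measurable]: "(\<lambda>r. \<theta> r v) \<in> borel_measurable borel"
  by (rule borel_measurable_continuous_onI[OF theta_cont_ray])

text \<open>Comparison with \<open>\<epsilon> / r\<^sup>2\<close>, whose antiderivative is
  \<open>- \<epsilon> / r\<close>. The decay in \<open>t\<close> is what later yields the derivative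
  zero at infinite directions.\<close>

lemma theta_tail:
  assumes t: "0 < t" and \<epsilon>: "0 \<le> \<epsilon>" and le: "\<And>r. t \<le> r \<Longrightarrow> r\<^sup>2 * \<theta> r v \<le> \<epsilon>"
  shows "set_integrable lborel {t<..} (\<lambda>r. \<theta> r v)"
    and "0 \<le> (LINT r:{t<..}|lborel. \<theta> r v)" "(LINT r:{t<..}|lborel. \<theta> r v) \<le> \<epsilon> / t"
proof -
  let ?F = "\<lambda>r. indicator {t<..} r *\<^sub>R \<theta> r v"
  have nonneg: "0 \<le> ?F r" for r
    using t theta_nonneg[of r v] by (auto split: split_indicator)
  have "(\<integral>\<^sup>+r. ennreal (?F r) \<partial>lborel) \<le> (\<integral>\<^sup>+r. ennreal (\<epsilon> / r\<^sup>2) * indicator {t..} r \<partial>lborel)"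
  proof (intro nn_integral_mono)
    fix r
    show "ennreal (?F r) \<le> ennreal (\<epsilon> / r\<^sup>2) * indicator {t..} r"
    proof (cases "t < r")
      case True
      then have "\<theta> r v \<le> \<epsilon> / r\<^sup>2" using le[of r] t by (simp add: field_simps)
      then show ?thesis using True by (simp add: ennreal_leI)
    qed simp
  qed
  also have "\<dots> = ennreal (0 - (- \<epsilon> / t))"
  proof (rule nn_integral_FTC_atLeast)
    show "DERIV (\<lambda>r. - \<epsilon> / r) r :> \<epsilon> / r\<^sup>2" if "t \<le> r" for r
      using that t by (auto intro!: derivative_eq_intros simp: power2_eq_square)
    show "((\<lambda>r. - \<epsilon> / r) \<longlongrightarrow> 0) at_top"
      by (rule real_tendsto_divide_at_top[OF tendsto_const filterlim_ident])
  qed (use \<epsilon> in auto)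
  finally have nn: "(\<integral>\<^sup>+r. ennreal (?F r) \<partial>lborel) \<le> ennreal (\<epsilon> / t)" by simp
  have meas: "?F \<in> borel_measurable lborel" by simp
  show int: "set_integrable lborel {t<..} (\<lambda>r. \<theta> r v)"
    unfolding set_integrable_def
  proof (rule integrableI_bounded[OF meas])
    have "(\<integral>\<^sup>+r. ennreal (norm (?F r)) \<partial>lborel) = (\<integral>\<^sup>+r. ennreal (?F r) \<partial>lborel)"
      using nonneg by (intro nn_integral_cong) (simp only: real_norm_def abs_of_nonneg)
    also have "\<dots> < \<infinity>" using nn by (rule order.strict_trans1) simp
    finally show "(\<integral>\<^sup>+r. ennreal (norm (?F r)) \<partial>lborel) < \<infinity>" .
  qed
  show "0 \<le> (LINT r:{t<..}|lborel. \<theta> r v)"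
    unfolding set_lebesgue_integral_def using nonneg by (intro integral_nonneg_AE) auto
  have eq: "ennreal (LINT r:{t<..}|lborel. \<theta> r v) = (\<integral>\<^sup>+r. ennreal (?F r) \<partial>lborel)"
    unfolding set_lebesgue_integral_def
    using int nonneg by (intro nn_integral_eq_integral[symmetric]) (auto simp: set_integrable_def)
  show "(LINT r:{t<..}|lborel. \<theta> r v) \<le> \<epsilon> / t"
    using nn \<epsilon> t unfolding eq[symmetric] by (subst (asm) ennreal_le_iff) auto
qed

lemma theta_integrable_Icc: "set_integrable lborel {0..t} (\<lambda>r. \<theta> r v)"
  by (rule borel_integrable_atLeastAtMost'[OF theta_cont_ray])

lemma theta_integrable:
  assumes "norm v = 1"
  shows "set_integrable lborel {0..} (\<lambda>r. \<theta> r v)"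
proof -
  obtain R where R: "1 \<le> R" "\<And>r v. R \<le> r \<Longrightarrow> norm v = 1 \<Longrightarrow> r\<^sup>2 * \<theta> r v \<le> 1"
    using theta_growth[of 1] by auto
  have "set_integrable lborel {R<..} (\<lambda>r. \<theta> r v)"
    using R assms by (intro theta_tail(1)[of R 1]) auto
  then have "set_integrable lborel ({0..R} \<union> {R<..}) (\<lambda>r. \<theta> r v)"
    by (intro set_integrable_Un theta_integrable_Icc) auto
  also have "{0..R} \<union> {R<..} = {0..}" using R by auto
  finally show ?thesis .
qed

lemma radii_borel: "radii x v \<in> sets borel"
proof -
  have "closed {r. E (x, r *\<^sub>R A v) \<le> h x}"
    by (intro closed_Collect_le continuous_intros cont_rules) auto
  then have "closed ({0..} \<inter> {r. E (x, r *\<^sub>R A v) \<le> h x})" by (intro closed_Int) auto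
  also have "{0..} \<inter> {r. E (x, r *\<^sub>R A v) \<le> h x} = radii x v" by (auto simp: radii_def)
  finally show ?thesis by simp
qed

lemma theta_integrable_radii: "norm v = 1 \<Longrightarrow> set_integrable lborel (radii x v) (\<lambda>r. \<theta> r v)"
  by (rule set_integrable_subset[OF theta_integrable]) (use radii_borel in \<open>auto simp: radii_def\<close>)

lemma radial_integral_DERIV:
  assumes "0 < t"
  shows "((\<lambda>t. LINT r:{0..t}|lborel. \<theta> r v) has_real_derivative \<theta> t v) (at t)"
proof -
  have eq: "(LINT r:{0..t}|lborel. \<theta> r v) = integral {0..t} (\<lambda>r. \<theta> r v)" for t
    by (rule set_borel_integral_eq_integral(2)[OF theta_integrable_Icc])
  have "((\<lambda>t. integral {0..t} (\<lambda>r. \<theta> r v)) has_real_derivative \<theta> t v) (at t within {0..t + 1})"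
    using assms by (intro integral_has_real_derivative theta_cont_ray) auto
  then show ?thesis unfolding eq using assms by (simp add: at_within_Icc_at)
qed

lemma eventually_slice_nhds:
  fixes x0 :: "'p::t2_space" and v :: "'q::t2_space"
  shows "\<forall>\<^sub>F p in nhds (x0, v). P p \<Longrightarrow> \<forall>\<^sub>F x in nhds x0. P (x, v)"
proof -
  assume ev: "\<forall>\<^sub>F p in nhds (x0, v). P p"
  have "isCont (\<lambda>x. (x, v)) x0" by (intro continuous_intros)
  then have "((\<lambda>x. (x, v)) \<longlongrightarrow> (x0, v)) (nhds x0)" by (rule isCont_tendsto_nhds)
  then show ?thesis using ev unfolding filterlim_iff by blast
qed

text \<open>The \<open>at\<close> filter leaves out the point \<open>(x0, v)\<close> itself, so
  \<open>P\<close> is assumed there separately.\<close>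

lemma eventually_slice:
  assumes "\<forall>\<^sub>F p in at (x0, v) within slater_set \<times> sphere 0 1. P p" "P (x0, v)" "x0 \<in> slater_set" "norm v = 1"
  shows "\<forall>\<^sub>F x in nhds x0. P (x, v)"
proof -
  have "\<forall>\<^sub>F p in nhds (x0, v). p \<in> slater_set \<times> sphere 0 1 \<longrightarrow> P p"
    using assms(1) unfolding eventually_at_filter by eventually_elim (use assms(2) in blast)
  then have "\<forall>\<^sub>F x in nhds x0. (x, v) \<in> slater_set \<times> sphere 0 1 \<longrightarrow> P (x, v)"
    by (rule eventually_slice_nhds)
  moreover have "\<forall>\<^sub>F x in nhds x0. x \<in> slater_set"
    using open_slater_set assms(3) by (rule eventually_nhds_in_open)
  ultimately show ?thesis by eventually_elim (use assms(4) in simp)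
qed

text \<open>A convex function that is bounded above on a half-line cannot increase anywhere on it;
  here the bound is \<open>h x\<close>.\<close>

lemma inf_ray_le:
  assumes "x \<in> slater_set" "norm v = 1" "v \<notin> Fin x" "0 \<le> r"
  shows "E (x, r *\<^sub>R A v) \<le> E (x, 0)"
proof -
  let ?d = "snd (g (x, r *\<^sub>R A v)) \<bullet> A v"
  have "?d \<le> 0"
  proof (rule ccontr)
    assume "\<not> ?d \<le> 0"
    then have d: "0 < ?d" by simp
    \<comment> \<open>The parameter at which the tangent at \<open>r\<close> reaches the level
      \<open>h x\<close>.\<close>
    let ?s = "r + (h x - E (x, r *\<^sub>R A v)) / ?d"
    have "0 \<le> (h x - E (x, r *\<^sub>R A v)) / ?d" using inf_dir[OF assms] d by simp
    then have "E (x, ?s *\<^sub>R A v) < h x" using assms by (intro inf_dir) auto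
    moreover have "E (x, r *\<^sub>R A v) + (?s - r) * ?d \<le> E (x, ?s *\<^sub>R A v)" by (rule E_ray)
    ultimately show False using d by simp
  qed
  then have "0 \<le> (0 - r) * ?d" using assms(4) by (simp add: mult_nonneg_nonpos)
  then show ?thesis using E_ray[of x r v 0] by simp
qed

text \<open>At an infinite direction the lost mass is at most \<open>\<eta> / \<rho>(x, v)\<close> with arbitrarily small \<open>\<eta>\<close>,
  while \<open>1 / \<rho>(x, v) = O(|x - x0|)\<close>, so the derivative there is zero.\<close>

lemma ray_prob_GDERIV:
  assumes x0: "x0 \<in> slater_set" and v: "norm v = 1"
  shows "GDERIV (\<lambda>x. ray_prob x v) x0 :> G x0 v"
proof (cases "v \<in> Fin x0")
  case True
  note r = rho_props[OF x0 True]
  note lim = rho_tendsto[OF x0 v True]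
  let ?u = "(x0, \<rho> x0 v *\<^sub>R A v)"
  let ?c = "snd (g ?u) \<bullet> A v"
  have fin: "\<forall>\<^sub>F x in nhds x0. v \<in> Fin x"
    using eventually_slice[OF lim(1) _ x0 v] True by simp
  moreover have "\<forall>\<^sub>F x in nhds x0. x \<in> slater_set"
    using open_slater_set x0 by (rule eventually_nhds_in_open)
  ultimately have ev: "\<forall>\<^sub>F x in nhds x0. x \<in> slater_set \<and> v \<in> Fin x" by eventually_elim simp
  have "((\<lambda>x. \<rho> x v) \<longlongrightarrow> \<rho> x0 v) (nhds x0)"
  proof (rule tendstoI)
    fix \<epsilon> :: real assume "0 < \<epsilon>"
    with lim(2) have "\<forall>\<^sub>F p in at (x0, v) within slater_set \<times> sphere 0 1. dist (\<rho> (fst p) (snd p)) (\<rho> x0 v) < \<epsilon>"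
      by (rule tendstoD)
    from eventually_slice[OF this _ x0 v] show "\<forall>\<^sub>F x in nhds x0. dist (\<rho> x v) (\<rho> x0 v) < \<epsilon>"
      using \<open>0 < \<epsilon>\<close> by simp
  qed
  then have cont: "isCont (\<lambda>x. \<rho> x v) x0"
    unfolding isCont_def by (rule tendsto_at_iff_tendsto_nhds[THEN iffD2])
  \<comment> \<open>The radius solves the equation that this gap is zero; the radial partial
    derivative \<open>?c\<close> is the crossing slope.\<close>
  have "GDERIV (\<lambda>q. E (fst q, snd q *\<^sub>R A v) - h (fst q)) (x0, \<rho> x0 v) :> (fst (g ?u) - dh x0, ?c)"
  proof -
    have "((\<lambda>q. E (fst q, snd q *\<^sub>R A v)) has_derivative (\<lambda>k. (fst k, snd k *\<^sub>R A v) \<bullet> g ?u)) (at (x0, \<rho> x0 v))"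
      by (rule has_derivative_compose[where g = E and f = "\<lambda>q. (fst q, snd q *\<^sub>R A v)"])
        (use E_GDERIV[of ?u] in \<open>auto intro!: derivative_eq_intros simp: gderiv_def\<close>)
    moreover have "((\<lambda>q. h (fst q)) has_derivative (\<lambda>k. fst k \<bullet> dh x0)) (at (x0, \<rho> x0 v))"
      by (rule has_derivative_compose[where g = h and f = fst])
        (use h_GDERIV[of x0] in \<open>auto intro!: derivative_eq_intros simp: gderiv_def\<close>)
    ultimately have "((\<lambda>q. E (fst q, snd q *\<^sub>R A v) - h (fst q)) has_derivative
        (\<lambda>k. (fst k, snd k *\<^sub>R A v) \<bullet> g ?u - fst k \<bullet> dh x0)) (at (x0, \<rho> x0 v))"
      by (rule has_derivative_diff)
    moreover have "(\<lambda>k. (fst k, snd k *\<^sub>R A v) \<bullet> g ?u - fst k \<bullet> dh x0) = (\<lambda>k. k \<bullet> (fst (g ?u) - dh x0, ?c))"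
      by (auto simp: fun_eq_iff inner_prod_def inner_diff_right inner_commute algebra_simps)
    ultimately show ?thesis unfolding gderiv_def by simp
  qed
  then have "GDERIV (\<lambda>x. \<rho> x v) x0 :> - (1 / ?c) *\<^sub>R (fst (g ?u) - dh x0)"
  proof (rule implicit_GDERIV[where \<rho> = "\<lambda>x. \<rho> x v"])
    show "0 < ?c" using crossing_slope_pos[OF x0 r(1), of v] r(2) by simp
    show "\<forall>\<^sub>F x in nhds x0. E (fst (x, \<rho> x v), snd (x, \<rho> x v) *\<^sub>R A v) - h (fst (x, \<rho> x v))
        = E (fst (x0, \<rho> x0 v), snd (x0, \<rho> x0 v) *\<^sub>R A v) - h (fst (x0, \<rho> x0 v))"
      using ev by eventually_elim (use rho_props(2) r(2) in simp)
  qed (rule cont)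
  then have "GDERIV (\<lambda>x. LINT r:{0..\<rho> x v}|lborel. \<theta> r v) x0 :> \<theta> (\<rho> x0 v) v *\<^sub>R (- (1 / ?c) *\<^sub>R (fst (g ?u) - dh x0))"
    by (rule GDERIV_DERIV_compose) (rule radial_integral_DERIV[OF r(1)])
  also have "\<theta> (\<rho> x0 v) v *\<^sub>R (- (1 / ?c) *\<^sub>R (fst (g ?u) - dh x0)) = G x0 v"
    unfolding G_fin[OF True] ray_grad_def by simp
  finally have d: "((\<lambda>x. LINT r:{0..\<rho> x v}|lborel. \<theta> r v) has_derivative (\<lambda>k. k \<bullet> G x0 v)) (at x0)"
    unfolding gderiv_def .
  have eq: "\<forall>\<^sub>F x in nhds x0. (LINT r:{0..\<rho> x v}|lborel. \<theta> r v) = ray_prob x v"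
    using ev by eventually_elim (simp add: ray_prob_def rho_props(3))
  show ?thesis
    unfolding gderiv_def
  proof (rule has_derivative_transform_eventually[OF d])
    show "\<forall>\<^sub>F x in at x0. (LINT r:{0..\<rho> x v}|lborel. \<theta> r v) = ray_prob x v"
      using eq by (auto simp: eventually_at_filter elim: eventually_mono)
  qed (use r(3) in \<open>simp_all add: ray_prob_def\<close>)
next
  case False
  obtain \<delta>0 B where B: "0 < B"
    "\<forall>\<^sub>F x in nhds x0. x \<in> slater_set \<and> \<delta>0 \<le> h x - E (x, 0) \<and> norm (g (x, 0)) \<le> B \<and> norm (dh x) \<le> B"
    using local_bounds[OF x0] by blast
  \<comment> \<open>This gap is measured against the fixed value \<open>E (x0, 0)\<close>: near
    \<open>x0\<close> the difference \<open>h x - E (x0, 0)\<close> is still at least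
    \<open>\<delta>\<close>.\<close>
  define \<delta> where "\<delta> = (h x0 - E (x0, 0)) / 2"
  have \<delta>: "0 < \<delta>" using x0 by (simp add: \<delta>_def slater_set_def)
  define K where "K = B + \<kappa> * onorm A"
  have K: "0 < K" using B kappa_nonneg onorm_A_nonneg by (simp add: K_def add_pos_nonneg)
  show ?thesis
  proof (rule GDERIV_I)
    fix \<epsilon> :: real assume \<epsilon>: "0 < \<epsilon>"
    \<comment> \<open>Chosen so that \<open>\<eta> / t\<close> is at most
      \<open>\<epsilon> * norm (x - x0)\<close> once
      \<open>\<delta> \<le> K * t * norm (x - x0)\<close> is known.\<close>
    define \<eta> where "\<eta> = \<epsilon> * \<delta> / K"
    have \<eta>: "0 < \<eta>" using \<epsilon> \<delta> K by (simp add: \<eta>_def)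
    obtain R where R: "1 \<le> R" "\<And>r v. R \<le> r \<Longrightarrow> norm v = 1 \<Longrightarrow> r\<^sup>2 * \<theta> r v \<le> \<eta>"
      using theta_growth[OF \<eta>] by blast
    have "(h \<longlongrightarrow> h x0) (nhds x0)"
      using h_cont by (intro isCont_tendsto_nhds) (simp add: continuous_on_eq_continuous_at)
    then have "\<forall>\<^sub>F x in nhds x0. h x0 - \<delta> < h x" using \<delta> by (intro order_tendstoD(1)) auto
    moreover have "\<forall>\<^sub>F x in nhds x0. v \<in> Fin x \<longrightarrow> R < \<rho> x v"
      using eventually_slice_nhds[OF rho_large[OF x0 v False, of R]] R by simp
    ultimately have "\<forall>\<^sub>F x in nhds x0. \<bar>ray_prob x v - ray_prob x0 v - G x0 v \<bullet> (x - x0)\<bar> \<le> \<epsilon> * norm (x - x0)"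
      using B(2)
    proof eventually_elim
      case (elim x)
      show ?case
      proof (cases "v \<in> Fin x")
        case True
        define t where "t = \<rho> x v"
        have x: "x \<in> slater_set" using elim by blast
        note r = rho_props[OF x True, folded t_def]
        have t: "R \<le> t" "1 \<le> t" using elim True R by (auto simp: t_def)
        have t0: "0 < t" "0 \<le> \<eta>" using t \<eta> by auto
        have le: "r\<^sup>2 * \<theta> r v \<le> \<eta>" if "t \<le> r" for r
          using that t R(2)[OF _ v] by simp
        note tail = theta_tail(2,3,1)[OF t0 le]
        \<comment> \<open>Over \<open>x0\<close> the whole ray counts, over \<open>x\<close> only
          its part up to \<open>t\<close>, so the difference is a tail.\<close>
        have "ray_prob x0 v = (LINT r:{0..t} \<union> {t<..}|lborel. \<theta> r v)"
          unfolding ray_prob_def inf_radii[OF x0 v False] using r(1) by (intro arg_cong2[where f = "set_lebesgue_integral lborel"]) auto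
        also have "\<dots> = (LINT r:{0..t}|lborel. \<theta> r v) + (LINT r:{t<..}|lborel. \<theta> r v)"
          using tail by (intro set_integral_Un theta_integrable_Icc) auto
        also have "(LINT r:{0..t}|lborel. \<theta> r v) = ray_prob x v" by (simp add: ray_prob_def r(3))
        finally have diff: "\<bar>ray_prob x v - ray_prob x0 v\<bar> \<le> \<eta> / t" using tail by simp
        let ?u = "(x, t *\<^sub>R A v)"
        \<comment> \<open>Comparing points of equal radius leaves only the
          \<open>x\<close>-component of the displacement, while the gradient contributes at most
          \<open>K * t\<close>; this bounds \<open>1 / t\<close> by a multiple of the
          distance.\<close>
        have "E ?u + g ?u \<bullet> ((x0, t *\<^sub>R A v) - ?u) \<le> E (x0, t *\<^sub>R A v)" by (rule E_subgradient)
        also have "\<dots> \<le> E (x0, 0)" using t by (intro inf_ray_le x0 v False) auto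
        finally have "h x - E (x0, 0) \<le> - (g ?u \<bullet> (x0 - x, 0))" using r(2) by simp
        also have "\<dots> \<le> norm (g ?u) * norm (x0 - x, 0 :: real^'m)"
          using Cauchy_Schwarz_ineq2[of "g ?u" "(x0 - x, 0)"] by linarith
        also have "\<dots> = norm (g ?u) * norm (x - x0)" by (simp add: norm_Pair norm_minus_commute)
        also have "\<dots> \<le> (K * t) * norm (x - x0)"
        proof (rule mult_right_mono)
          have "norm (g ?u) \<le> (norm (g (x, 0)) + \<kappa> * onorm A) * t" by (rule g_ray_bound[OF v t(2)])
          also have "\<dots> \<le> K * t" unfolding K_def using elim t by (intro mult_right_mono) auto
          finally show "norm (g ?u) \<le> K * t" .
        qed simp
        finally have "\<delta> \<le> K * t * norm (x - x0)" using elim(1) by (simp add: \<delta>_def field_simps)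
        then have "\<epsilon> * \<delta> / K / t \<le> \<epsilon> * norm (x - x0)"
          using K t \<epsilon> by (simp add: field_simps)
        then show ?thesis using diff by (simp add: \<eta>_def G_inf[OF False])
      next
        case nfin: False
        have "ray_prob x v = ray_prob x0 v"
          unfolding ray_prob_def using inf_radii[OF x0 v False] inf_radii[OF _ v nfin] elim by simp
        then show ?thesis using \<epsilon> by (simp add: G_inf[OF False])
      qed
    qed
    then show "\<exists>d>0. \<forall>x. norm (x - x0) < d \<longrightarrow> \<bar>ray_prob x v - ray_prob x0 v - G x0 v \<bullet> (x - x0)\<bar> \<le> \<epsilon> * norm (x - x0)"
      unfolding eventually_nhds_metric dist_norm by blast
  qed
qed

subsection \<open>The probability function\<close>

text \<open>Reconciles two normalisations of the sphere area, through Gamma(m/2 + 1) = m/2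
  Gamma(m/2).\<close>

lemma radial_weight_eq:
  "radial_weight TYPE(real^'m) r * \<bar>det L\<bar> = radial_const * r ^ (CARD('m) - 1)"
proof -
  let ?m = "real CARD('m)"
  have m: "0 < ?m" by simp
  have plus1: "Gamma (?m / 2 + 1) = ?m / 2 * Gamma (?m / 2)"
    using m by (intro Gamma_plus1) (auto dest: nonpos_Ints_nonpos)
  define X where "X = Gamma (?m / 2)"
  have "0 < X" unfolding X_def using m by (intro Gamma_real_pos) simp
  then have "?m * unit_ball_vol ?m = 2 * pi powr (?m / 2) / Gamma (?m / 2)"
    using m unfolding unit_ball_vol_def plus1 X_def[symmetric] by (simp add: field_simps)
  then show ?thesis by (simp add: radial_weight_def radial_const_def)
qed

text \<open>A parameter integral of a jointly measurable function: in the pair (v, r) the constraint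
  set is closed and the density continuous.\<close>

lemma ray_prob_measurable: "ray_prob x \<in> borel_measurable sphere_uniform"
proof -
  define q :: "(real^'m) \<times> real \<Rightarrow> real" where "q = (\<lambda>p. indicator {p. 0 \<le> snd p \<and> E (x, snd p *\<^sub>R A (fst p)) \<le> h x} p *\<^sub>R \<theta> (snd p) (fst p))"
  have "closed ({p :: (real^'m) \<times> real. 0 \<le> snd p} \<inter> {p. E (x, snd p *\<^sub>R A (fst p)) \<le> h x})"
    by (intro closed_Int closed_Collect_le continuous_intros cont_rules) auto
  then have c: "{p :: (real^'m) \<times> real. 0 \<le> snd p \<and> E (x, snd p *\<^sub>R A (fst p)) \<le> h x} \<in> sets borel"
    by (simp add: Collect_conj_eq)
  have "continuous_on UNIV (\<lambda>p :: (real^'m) \<times> real. \<theta> (snd p) (fst p))"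
    unfolding theta_eq by (intro continuous_intros cont_rules) auto
  then have "q \<in> borel_measurable borel"
    unfolding q_def using c by (intro borel_measurable_scaleR borel_measurable_indicator borel_measurable_continuous_onI) auto
  then have "q \<in> borel_measurable (borel \<Otimes>\<^sub>M lborel)"
    by (subst measurable_cong_sets[of _ borel]) (simp_all add: borel_prod[symmetric] cong: sets_pair_measure_cong)
  then have "(\<lambda>(v, r). q (v, r)) \<in> borel_measurable (borel \<Otimes>\<^sub>M lborel)"
    by (simp only: case_prod_eta)
  then have "(\<lambda>v. \<integral>r. q (v, r) \<partial>lborel) \<in> borel_measurable borel"
    by (rule sigma_finite_measure.borel_measurable_lebesgue_integral[OF sigma_finite_lborel])
  also have "(\<lambda>v. \<integral>r. q (v, r) \<partial>lborel) = ray_prob x"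
    unfolding ray_prob_def set_lebesgue_integral_def radii_def q_def by (simp add: indicator_def fun_eq_iff)
  finally show ?thesis
    unfolding measurable_cong_sets[OF sets_sphere_uniform refl] by (rule measurable_restrict_space1)
qed

lemma ray_prob_nonneg: "0 \<le> ray_prob x v"
  unfolding ray_prob_def set_lebesgue_integral_def
  by (intro integral_nonneg_AE) (auto simp: radii_def theta_nonneg split: split_indicator)

lemma nn_integral_ray:
  assumes "norm v = 1"
  shows "(\<integral>\<^sup>+r. ennreal (radial_weight TYPE(real^'m) r) * indicator {0..} r *
      (ennreal \<bar>det L\<bar> * (ennreal (f (A (r *\<^sub>R v))) * indicator {z. E (x, z) \<le> h x} (A (r *\<^sub>R v)))) \<partial>lborel)
    = ennreal (ray_prob x v)"
proof -
  have "(\<integral>\<^sup>+r. ennreal (indicator (radii x v) r *\<^sub>R \<theta> r v) \<partial>lborel) = ennreal (ray_prob x v)"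
    unfolding ray_prob_def set_lebesgue_integral_def
    using theta_integrable_radii[OF assms]
    by (intro nn_integral_eq_integral) (auto simp: set_integrable_def radii_def theta_nonneg split: split_indicator)
  moreover have "ennreal (radial_weight TYPE(real^'m) r) * indicator {0..} r *
      (ennreal \<bar>det L\<bar> * (ennreal (f (A (r *\<^sub>R v))) * indicator {z. E (x, z) \<le> h x} (A (r *\<^sub>R v))))
    = ennreal (indicator (radii x v) r *\<^sub>R \<theta> r v)" for r
  proof (cases "r \<in> radii x v")
    case True
    then have r: "0 \<le> r" "E (x, r *\<^sub>R A v) \<le> h x" by (auto simp: radii_def)
    have w: "0 \<le> radial_weight TYPE(real^'m) r" using r by (simp add: radial_weight_def)
    have "ennreal (radial_weight TYPE(real^'m) r) * (ennreal \<bar>det L\<bar> * ennreal (f (r *\<^sub>R A v)))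
        = ennreal (radial_weight TYPE(real^'m) r * \<bar>det L\<bar> * f (r *\<^sub>R A v))"
      using w f_nonneg by (simp add: ennreal_mult mult.assoc)
    then show ?thesis
      using True r by (simp add: matrix_vector_mult_scaleR radial_weight_eq theta_eq)
  qed (auto simp: radii_def matrix_vector_mult_scaleR split: split_indicator)
  ultimately show ?thesis by simp
qed

text \<open>The substitution by \<open>L\<close> precedes polar coordinates because the rays are
  \<open>r *\<^sub>R A v\<close> with \<open>v\<close> on the Euclidean sphere. Integrability comes
  from the total being a probability.\<close>

lemma prob_function_polar:
  assumes M: "prob_space M" and \<xi>: "distributed M lborel \<xi> (\<lambda>z. ennreal (f z))"
  shows "integrable sphere_uniform (ray_prob x)"
    and "prob_function M \<xi> E h x = (\<integral>v. ray_prob x v \<partial>sphere_uniform)"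
proof -
  interpret prob_space M by (rule M)
  let ?S = "{z. E (x, z) \<le> h x}"
  have "closed ?S" by (intro closed_Collect_le continuous_intros cont_rules) auto
  then have S[measurable]: "?S \<in> sets borel" by simp
  have f_m[measurable]: "f \<in> borel_measurable borel"
    by (rule borel_measurable_continuous_onI[OF f_cont])
  have A_m[measurable]: "A \<in> borel_measurable borel"
    by (rule borel_measurable_continuous_onI[OF A_cont])
  have "{\<omega> \<in> space M. E (x, \<xi> \<omega>) \<le> h x} = \<xi> -` ?S \<inter> space M" by auto
  then have "emeasure M {\<omega> \<in> space M. E (x, \<xi> \<omega>) \<le> h x} = (\<integral>\<^sup>+z. ennreal (f z) * indicator ?S z \<partial>lborel)"
    using distributed_emeasure[OF \<xi>, of ?S] by simp
  also have "\<dots> = (\<integral>\<^sup>+z. ennreal (f z) * indicator ?S z \<partial>density (distr lborel borel A) (\<lambda>_. ennreal \<bar>det L\<bar>))"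
    by (subst lborel_eq_linear_image[OF L_inv]) simp
  also have "\<dots> = (\<integral>\<^sup>+z. ennreal \<bar>det L\<bar> * (ennreal (f (A z)) * indicator ?S (A z)) \<partial>lborel)"
    by (subst nn_integral_density, simp, simp, subst nn_integral_distr) simp_all
  also have "\<dots> = (\<integral>\<^sup>+v. \<integral>\<^sup>+r. ennreal (radial_weight TYPE(real^'m) r) * indicator {0..} r *
      (ennreal \<bar>det L\<bar> * (ennreal (f (A (r *\<^sub>R v))) * indicator ?S (A (r *\<^sub>R v)))) \<partial>lborel \<partial>sphere_uniform)"
    by (rule nn_integral_polar) simp
  also have "\<dots> = (\<integral>\<^sup>+v. ennreal (ray_prob x v) \<partial>sphere_uniform)"
    by (intro nn_integral_cong nn_integral_ray) (simp add: space_sphere_uniform)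
  finally have eq: "(\<integral>\<^sup>+v. ennreal (ray_prob x v) \<partial>sphere_uniform) = ennreal (prob_function M \<xi> E h x)"
    unfolding prob_function_def by (simp add: emeasure_eq_measure)
  show int: "integrable sphere_uniform (ray_prob x)"
    by (rule integrableI_nn_integral_finite[OF ray_prob_measurable _ eq]) (simp add: ray_prob_nonneg)
  have "ennreal (\<integral>v. ray_prob x v \<partial>sphere_uniform) = ennreal (prob_function M \<xi> E h x)"
    using nn_integral_eq_integral[OF int] eq ray_prob_nonneg by simp
  then show "prob_function M \<xi> E h x = (\<integral>v. ray_prob x v \<partial>sphere_uniform)"
    using ray_prob_nonneg by (subst (asm) ennreal_inj) (auto simp: prob_function_def intro: integral_nonneg_AE)
qed

theorem prob_function_C1:
  assumes "prob_space M" "distributed M lborel \<xi> (\<lambda>z. ennreal (f z))"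
  shows "C1_on slater_set (prob_function M \<xi> E h)"
    and "\<And>x. x \<in> slater_set \<Longrightarrow> integrable sphere_uniform (G x)"
    and "\<And>x. x \<in> slater_set \<Longrightarrow> grad (prob_function M \<xi> E h) x = (\<integral>v. G x v \<partial>sphere_uniform)"
proof -
  have fin: "finite_measure (sphere_uniform :: (real^'m) measure)"
    using prob_space_sphere_uniform prob_space_def by blast
  note D = GDERIV_integral[OF fin sets_sphere_uniform compact_sphere open_slater_set
      prob_function_polar(1)[OF assms] ray_prob_GDERIV G_cont, simplified]
  have phi: "prob_function M \<xi> E h = (\<lambda>x. \<integral>v. ray_prob x v \<partial>sphere_uniform)"
    using prob_function_polar(2)[OF assms] by (simp add: fun_eq_iff)
  have gr: "grad (prob_function M \<xi> E h) x = (\<integral>v. G x v \<partial>sphere_uniform)" if "x \<in> slater_set" for x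
    unfolding phi using D(2)[OF that] by (rule grad_eq)
  show "C1_on slater_set (prob_function M \<xi> E h)"
    unfolding C1_on_def
  proof (intro conjI ballI)
    show "GDERIV (prob_function M \<xi> E h) x :> grad (prob_function M \<xi> E h) x" if "x \<in> slater_set" for x
      unfolding gr[OF that] unfolding phi by (rule D(2)[OF that])
    show "continuous_on slater_set (grad (prob_function M \<xi> E h))"
      using D(3) by (subst continuous_on_cong[OF refl gr])
  qed
  show "integrable sphere_uniform (G x)" if "x \<in> slater_set" for x using D(1)[OF that] .
  show "grad (prob_function M \<xi> E h) x = (\<integral>v. G x v \<partial>sphere_uniform)" if "x \<in> slater_set" for x
    using gr[OF that] .
qed

end

section \<open>Application to the envelope of the supremum function\<close>

lemma radial_level_moreau_env:
  fixes F :: "'h::euclidean_space \<times> (real^'m) \<Rightarrow> real"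
  assumes "convex_on UNIV F" "0 < lam" "C1_on UNIV h" "invertible L" "\<And>z. 0 \<le> f z" "continuous_on UNIV f"
    and "((\<lambda>z. norm z ^ (CARD('m) + 1) * f z) \<longlongrightarrow> 0) at_infinity"
  shows "radial_level (moreau_env lam F) (moreau_grad lam F) (1 / lam) h (grad h) L f"
  using assms moreau_env_GDERIV[OF assms(1,2)] moreau_env_subgradient[OF assms(1,2)] moreau_grad_lipschitz[OF assms(1,2)]
  unfolding C1_on_def by unfold_locales auto

theorem theorem4p3:
  fixes K :: "'y::banach set"
    and C :: "('y \<Rightarrow>\<^sub>L real) set"
    and \<Phi> :: "'h::euclidean_space \<times> (real^'m) \<Rightarrow> 'y"
    and h :: "'h \<Rightarrow> real"
    and M :: "'w measure"
    and \<xi> :: "'w \<Rightarrow> real^'m"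
    and f :: "real^'m \<Rightarrow> real"
    and L :: "real^'m^'m"
    and xbar :: 'h
    and lam :: real
  assumes K: "convex_cone K"
    and C_compact: "compactin weak_star C"
    and C_convex: "convex C"
    and C_generates: "weak_star closure_of (generated_cone C) = dual_cone K"
    and h_C1: "C1_on UNIV h"
    and h_convex: "convex_on UNIV h"
    and \<Phi>_convex: "\<And>v. v \<in> C \<Longrightarrow> convex_on UNIV (scalarised \<Phi> h v)"
    and M: "prob_space M"
    and f_nonneg: "\<And>z. 0 \<le> f z"
    and f_cont: "continuous_on UNIV f"
    and f_density: "distributed M lborel \<xi> (\<lambda>z. ennreal (f z))"
    and \<xi>_mean: "has_bochner_integral M \<xi> 0"
    and L: "invertible L"
    and slater: "sup_scalarised C \<Phi> h (xbar, 0) < h xbar"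
    and growth: "((\<lambda>z. norm z ^ (CARD('m) + 1) * f z) \<longlongrightarrow> 0) at_infinity"
    and lam: "0 < lam"
  shows "(\<exists>U. open U \<and> xbar \<in> U \<and>
      (\<forall>x\<in>U. moreau_env lam (sup_scalarised C \<Phi> h) (x, 0) < h x) \<and>
      C1_on U (prob_function M \<xi> (moreau_env lam (sup_scalarised C \<Phi> h)) h) \<and>
      (\<forall>x\<in>U.
        integrable sphere_uniform
          (gradient_integrand L f (moreau_env lam (sup_scalarised C \<Phi> h)) h x) \<and>
        grad (prob_function M \<xi> (moreau_env lam (sup_scalarised C \<Phi> h)) h) x =
          (LINT v|sphere_uniform.
            gradient_integrand L f (moreau_env lam (sup_scalarised C \<Phi> h)) h x v))) \<and>
    (\<forall>x z.
      (\<exists>v\<in>C. moreau_env lam (scalarised \<Phi> h v) (x, z)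
              = moreau_env lam (sup_scalarised C \<Phi> h) (x, z)) \<and>
      (\<forall>v\<in>C. moreau_env lam (scalarised \<Phi> h v) (x, z)
              = moreau_env lam (sup_scalarised C \<Phi> h) (x, z) \<longrightarrow>
        GDERIV (moreau_env lam (sup_scalarised C \<Phi> h)) (x, z) :>
          (1 / lam) *\<^sub>R ((x, z) - prox lam (scalarised \<Phi> h v) (x, z))))"
proof (intro conjI)
  let ?S = "sup_scalarised C \<Phi> h"
  let ?E = "moreau_env lam ?S"
  have "0 \<in> dual_cone K" by (simp add: dual_cone_def)
  \<comment> \<open>An empty \<open>C\<close> would generate the empty cone, whose closure does not
    contain 0.\<close>
  then have "C \<noteq> {}" using C_generates by (auto simp: generated_cone_def)
  then interpret scal: compact_scalarisation C \<Phi> h lam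
    using C_compact C_convex \<Phi>_convex lam by unfold_locales
  interpret radial_level ?E "moreau_grad lam ?S" "1 / lam" h "grad h" L f
    using scal.convex_sup lam h_C1 L f_nonneg f_cont growth by (rule radial_level_moreau_env)
  \<comment> \<open>With the point itself as competitor in the infimum, the envelope lies below the
    function, so the strict inequality passes from \<open>?S\<close> to \<open>?E\<close>.\<close>
  have "?E (xbar, 0) \<le> ?S (xbar, 0)"
    using moreau_env_le[OF scal.convex_sup lam, of "(xbar, 0)" "(xbar, 0)"] by simp
  then have "xbar \<in> slater_set" using slater by (simp add: slater_set_def)
  then show "\<exists>U. open U \<and> xbar \<in> U \<and>
      (\<forall>x\<in>U. ?E (x, 0) < h x) \<and>
      C1_on U (prob_function M \<xi> ?E h) \<and>
      (\<forall>x\<in>U. integrable sphere_uniform (gradient_integrand L f ?E h x) \<and>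
        grad (prob_function M \<xi> ?E h) x = (LINT v|sphere_uniform. gradient_integrand L f ?E h x v))"
    using open_slater_set prob_function_C1[OF M f_density]
    by (intro exI[of _ slater_set] conjI ballI) (auto simp: slater_set_def)
  show "\<forall>x z. (\<exists>v\<in>C. moreau_env lam (scalarised \<Phi> h v) (x, z) = ?E (x, z)) \<and>
      (\<forall>v\<in>C. moreau_env lam (scalarised \<Phi> h v) (x, z) = ?E (x, z) \<longrightarrow>
        GDERIV ?E (x, z) :> (1 / lam) *\<^sub>R ((x, z) - prox lam (scalarised \<Phi> h v) (x, z)))"
    using scal.active_exists scal.active_GDERIV by blast
qed

end
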